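(* Let $\lambda_0>0$, $\Omega>0$, $U_0=\lambda_0Y$, $V_0=0$, and consider on $Y>0$ the adjoint system $$-i\Omega u^\ast-\lambda_0Y\,u^\ast_X-u^\ast_{YY}-q_X=0,\qquad q_Y=\lambda_0u^\ast .$$ Let $\alpha\neq0$ be such that $c(\alpha)=(i\alpha\lambda_0)^{1/3}$ is defined (principal branch, cut along $\alpha\in i[0,\infty)$), and put $z=z(Y;\alpha)=c(\alpha)Y+z_0(\alpha)$, $z_0(\alpha)=-i\Omega/c(\alpha)^2$. Then an adjoint mode $(u^\ast,q)=(g(Y),\hat q(Y))e^{-i\alpha X}$ satisfies the reduced third-order equation $$g'''-(i\alpha\lambda_0Y-i\Omega)g'-2i\alpha\lambda_0g=0,\qquad\text{i.e.}\qquad g_{zzz}-z\,g_z-2g=0$$ in the variable $z$, and the adjoint pressure is recovered algebraically as $$\hat q=\frac{c^2}{i\alpha}\,h(z),\qquad h:=g_{zz}-z\,g,\qquad h_z=g .$$ A fundamental system of the third-order equation is $\{\mathrm{Ai}'(z),\mathrm{Bi}'(z),\mathrm{Gi}'(z)\}$, with companions $h$ equal to $\mathrm{Ai}(z),\mathrm{Bi}(z),\mathrm{Gi}(z)$ respectively. The solutions admissible as $Y\to+\infty$ are spanned by the recessive pair and the algebraically decaying Scorer pair, $$(g,\hat q)\in\operatorname{span}\Big\{\big(\mathrm{Ai}'(z),\tfrac{c^2}{i\alpha}\mathrm{Ai}(z)\big),\ \big(\mathrm{Gi}'(z),\tfrac{c^2}{i\alpha}\mathrm{Gi}(z)\big)\Big\},$$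 and the adjoint line states are finite and explicit; in particular, for the recessive component $u^\ast=\mathrm{Ai}'(z)e^{-i\alpha X}$, $$\bar U^\ast(X)=\int_0^\infty u^\ast\,dY=-\frac{\mathrm{Ai}(z_0)}{c}\,e^{-i\alpha X},\qquad \widehat b\propto i\alpha\,\frac{\mathrm{Ai}(z_0)}{c}.$$
   Context: $\mathrm{Ai},\mathrm{Bi}$ are the Airy functions and $\mathrm{Gi}$ the Scorer function, $\mathrm{Gi}''(z)-z\,\mathrm{Gi}(z)=-1/\pi$. "Admissible" means that $(g,\hat q)$ decays as $Y\to+\infty$. The adjoint line states are $b=\bar U^\ast_X$ and $\mu=H\partial_X[\bar U^\ast_X]$, where $\bar U^\ast(X)=\int_0^\infty u^\ast(X,Y)dY$ and $H\partial_X$ has Fourier symbol $|\alpha|$; $\widehat b$ denotes the amplitude of $b$ in the mode $e^{-i\alpha X}$. The principal branch gives $|\arg c|\le\pi/6$ for real $\alpha$. The adjoint system is the formal (bilinear) adjoint of the bulk equations $u_X+v_Y=0$, $-i\Omega u+\lambda_0Yu_X+\lambda_0v+p_X-u_{YY}=0$. *)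

theory Defs
  imports "HOL-Analysis.Analysis"
begin

section \<open>Airy and Scorer functions on the complex plane\<close>

text \<open>
  Taylor coefficients at 0 of the entire solution of \<open>f'' - z f = r\<close>, \<open>f(0) = a\<close>, \<open>f'(0) = b\<close>.
\<close>

fun airy_coeff :: "complex \<Rightarrow> complex \<Rightarrow> complex \<Rightarrow> nat \<Rightarrow> complex" where
  "airy_coeff r a b 0 = a"
| "airy_coeff r a b (Suc 0) = b"
| "airy_coeff r a b (Suc (Suc 0)) = r / 2"
| "airy_coeff r a b (Suc (Suc (Suc n))) = airy_coeff r a b n / of_nat ((n + 2) * (n + 3))"

definition airy_ivp :: "complex \<Rightarrow> complex \<Rightarrow> complex \<Rightarrow> complex \<Rightarrow> complex" where
  "airy_ivp r a b z = (\<Sum>n. airy_coeff r a b n * z ^ n)"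

text \<open>The standard normalisations, given through the values of the function and of its
  derivative at 0. For \<open>Gi\<close> these are a third of those of \<open>Bi\<close>.\<close>

definition Ai :: "complex \<Rightarrow> complex" where
  "Ai = airy_ivp 0 (of_real (1 / (3 powr (2/3) * Gamma (2/3))))
                   (of_real (- 1 / (3 powr (1/3) * Gamma (1/3))))"

definition Bi :: "complex \<Rightarrow> complex" where
  "Bi = airy_ivp 0 (of_real (1 / (3 powr (1/6) * Gamma (2/3))))
                   (of_real (3 powr (1/6) / Gamma (1/3)))"

definition Gi :: "complex \<Rightarrow> complex" where
  "Gi = airy_ivp (- 1 / of_real pi)
                 (of_real (1 / (3 powr (1/6) * Gamma (2/3)) / 3))
                 (of_real (3 powr (1/6) / Gamma (1/3) / 3))"

lemma airy_coeff_summable: "summable (\<lambda>n. airy_coeff r a b n * z ^ n)"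
proof -
  define K :: real where "K = 2 * (norm z + 1)"
  have K: "K > 0" "norm z / K < 1" "norm z \<ge> 0"
  proof -
    have "0 < norm z + 1" "0 < norm z + 2" by (auto intro!: add_nonneg_pos)
    then show "K > 0" "norm z / K < 1" unfolding K_def by (simp_all add: divide_less_eq)
  qed simp
  define t where "t n = norm (airy_coeff r a b n) * K ^ n" for n
  obtain N :: nat where N: "real N \<ge> K ^ 3"
    using real_arch_simple by blast
  have step: "t (Suc (Suc (Suc n))) \<le> t n" if "n \<ge> N" for n
  proof -
    have "K ^ 3 \<le> real n" using N that by linarith
    also have "real n \<le> real ((n + 2) * (n + 3))" by (simp only: of_nat_le_iff) simp
    finally have *: "K ^ 3 / real ((n + 2) * (n + 3)) \<le> 1"
      by (simp add: divide_le_eq del: of_nat_mult of_nat_add)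
    have "t (Suc (Suc (Suc n))) = t n * (K ^ 3 / real ((n + 2) * (n + 3)))"
      unfolding t_def airy_coeff.simps norm_divide norm_of_nat
      by (simp add: power3_eq_cube)
    also have "\<dots> \<le> t n * 1"
      by (rule mult_left_mono[OF *]) (use K in \<open>simp add: t_def\<close>)
    finally show ?thesis by simp
  qed
  define C where "C = Max (t ` {..N + 2})"
  have bound: "t n \<le> C" for n
  proof (induction n rule: less_induct)
    case (less n)
    show ?case
    proof (cases "n \<le> N + 2")
      case True
      then show ?thesis unfolding C_def by (intro Max_ge) auto
    next
      case False
      then obtain m where m: "n = Suc (Suc (Suc m))" "m \<ge> N"
        by (intro that[of "n - 3"]) auto
      have "t n \<le> t m" using step m by simp
      also have "\<dots> \<le> C" using less m by simp
      finally show ?thesis .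
    qed
  qed
  have "summable (\<lambda>n. C * (norm z / K) ^ n)"
    using K by (intro summable_mult summable_geometric) auto
  moreover have "norm (airy_coeff r a b n * z ^ n) \<le> C * (norm z / K) ^ n" for n
  proof -
    have "norm (airy_coeff r a b n * z ^ n) = t n * (norm z / K) ^ n"
      using K by (simp add: t_def norm_mult norm_power power_divide)
    also have "\<dots> \<le> C * (norm z / K) ^ n"
      using K by (intro mult_right_mono bound) auto
    finally show ?thesis .
  qed
  ultimately show ?thesis
    by (rule summable_comparison_test'[where N = 0])
qed

lemma airy_ivp_0: "airy_ivp r a b 0 = a"
  by (simp add: airy_ivp_def powser_zero)

lemma airy_ivp_has_deriv:
  "(airy_ivp r a b has_field_derivative (\<Sum>n. diffs (airy_coeff r a b) n * z ^ n)) (at z)"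
  unfolding airy_ivp_def[abs_def]
  by (intro termdiffs_strong_converges_everywhere airy_coeff_summable)

lemma deriv_airy_ivp: "deriv (airy_ivp r a b) = (\<lambda>z. \<Sum>n. diffs (airy_coeff r a b) n * z ^ n)"
  using DERIV_imp_deriv[OF airy_ivp_has_deriv] by blast

lemma deriv_airy_ivp_0: "deriv (airy_ivp r a b) 0 = b"
  by (simp add: deriv_airy_ivp powser_zero diffs_def)

lemma airy_ivp_ode:
  "(deriv (airy_ivp r a b) has_field_derivative (z * airy_ivp r a b z + r)) (at z)"
proof -
  let ?c = "airy_coeff r a b"
  have s1: "summable (\<lambda>n. diffs ?c n * x ^ n)" for x
    by (rule termdiff_converges_all) (rule airy_coeff_summable)
  have s2: "summable (\<lambda>n. diffs (diffs ?c) n * x ^ n)" for x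
    by (rule termdiff_converges_all) (rule s1)
  have shift: "diffs (diffs ?c) (Suc n) = ?c n" for n
  proof -
    have "(of_nat ((n + 2) * (n + 3)) :: complex) \<noteq> 0"
      by (subst of_nat_eq_0_iff) simp
    moreover have "diffs (diffs ?c) (Suc n) = of_nat ((n + 2) * (n + 3)) * ?c (Suc (Suc (Suc n)))"
      by (simp add: diffs_def numeral_eq_Suc flip: of_nat_mult mult.assoc
            del: of_nat_Suc airy_coeff.simps)
    ultimately show ?thesis by (simp only: airy_coeff.simps) simp
  qed
  have "(\<Sum>n. diffs (diffs ?c) n * z ^ n) = diffs (diffs ?c) 0 + (\<Sum>n. diffs (diffs ?c) (Suc n) * z ^ Suc n)"
    using suminf_split_head[OF s2[of z]] by simp
  also have "diffs (diffs ?c) 0 = r"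
    by (simp add: diffs_def)
  also have "(\<Sum>n. diffs (diffs ?c) (Suc n) * z ^ Suc n) = (\<Sum>n. z * (?c n * z ^ n))"
    by (simp only: shift power_Suc mult.left_commute)
  also have "\<dots> = z * airy_ivp r a b z"
    unfolding airy_ivp_def by (rule suminf_mult[OF airy_coeff_summable])
  finally have "(\<Sum>n. diffs (diffs ?c) n * z ^ n) = z * airy_ivp r a b z + r" by simp
  with termdiffs_strong_converges_everywhere[of "diffs ?c" z] s1 show ?thesis
    by (simp add: deriv_airy_ivp)
qed

lemma Airy_ode:
  "(deriv Ai has_field_derivative z * Ai z) (at z)"
  "(deriv Bi has_field_derivative z * Bi z) (at z)"
  "(deriv Gi has_field_derivative z * Gi z - 1 / of_real pi) (at z)"
  using airy_ivp_ode[of 0 _ _ z] airy_ivp_ode[of "- 1 / of_real pi" _ _ z]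
  by (simp_all add: Ai_def Bi_def Gi_def)


section \<open>The adjoint system and its modes\<close>

text \<open>Classical solutions for \<open>X\<close> real and \<open>Y > 0\<close>; \<open>l\<close> and \<open>W\<close> stand for
  \<open>\<lambda>\<^sub>0\<close> and \<open>\<Omega>\<close>.\<close>

definition adjoint_system ::
  "real \<Rightarrow> real \<Rightarrow> (real \<Rightarrow> real \<Rightarrow> complex) \<Rightarrow> (real \<Rightarrow> real \<Rightarrow> complex) \<Rightarrow> bool" where
  "adjoint_system l W u q \<longleftrightarrow>
     (\<exists>uX uY uYY qX qY. \<forall>X. \<forall>Y>0.
        ((\<lambda>x. u x Y) has_vector_derivative uX X Y) (at X) \<and>
        ((\<lambda>y. u X y) has_vector_derivative uY X Y) (at Y) \<and>
        ((\<lambda>y. uY X y) has_vector_derivative uYY X Y) (at Y) \<and>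
        ((\<lambda>x. q x Y) has_vector_derivative qX X Y) (at X) \<and>
        ((\<lambda>y. q X y) has_vector_derivative qY X Y) (at Y) \<and>
        - \<i> * of_real W * u X Y - of_real (l * Y) * uX X Y - uYY X Y - qX X Y = 0 \<and>
        qY X Y = of_real l * u X Y)"

definition plane_wave :: "complex \<Rightarrow> real \<Rightarrow> complex" where
  "plane_wave \<alpha> X = exp (- \<i> * \<alpha> * of_real X)"

definition adjoint_mode ::
  "real \<Rightarrow> real \<Rightarrow> complex \<Rightarrow> (real \<Rightarrow> complex) \<Rightarrow> (real \<Rightarrow> complex) \<Rightarrow> bool" where
  "adjoint_mode l W \<alpha> g q \<longleftrightarrow>
     adjoint_system l W (\<lambda>X Y. g Y * plane_wave \<alpha> X) (\<lambda>X Y. q Y * plane_wave \<alpha> X)"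

definition admissible :: "(real \<Rightarrow> complex) \<Rightarrow> (real \<Rightarrow> complex) \<Rightarrow> bool" where
  "admissible g q \<longleftrightarrow> (g \<longlongrightarrow> 0) at_top \<and> (q \<longlongrightarrow> 0) at_top"

definition reduced_equation_Y :: "real \<Rightarrow> real \<Rightarrow> complex \<Rightarrow> (real \<Rightarrow> complex) \<Rightarrow> bool" where
  "reduced_equation_Y l W \<alpha> g \<longleftrightarrow>
     (\<exists>g1 g2 g3. \<forall>Y>0.
        (g has_vector_derivative g1 Y) (at Y) \<and>
        (g1 has_vector_derivative g2 Y) (at Y) \<and>
        (g2 has_vector_derivative g3 Y) (at Y) \<and>
        g3 Y - (\<i> * \<alpha> * of_real l * of_real Y - \<i> * of_real W) * g1 Y
          - 2 * \<i> * \<alpha> * of_real l * g Y = 0)"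

text \<open>
  The equations in the variable \<open>z\<close> are posed on a set \<open>S\<close>: the whole plane, or the ray
  \<open>{cY + z\<^sub>0 | Y > 0}\<close>, where the derivative within \<open>S\<close> is the derivative along the ray,
  \<open>d/dz = c\<^sup>-\<^sup>1 d/dY\<close>.
\<close>

definition reduced_equation_z :: "complex set \<Rightarrow> (complex \<Rightarrow> complex) \<Rightarrow> bool" where
  "reduced_equation_z S G \<longleftrightarrow>
     (\<exists>G1 G2 G3. \<forall>w\<in>S.
        (G has_field_derivative G1 w) (at w within S) \<and>
        (G1 has_field_derivative G2 w) (at w within S) \<and>
        (G2 has_field_derivative G3 w) (at w within S) \<and>
        G3 w - w * G1 w - 2 * G w = 0)"

text \<open>\<open>h = G'' - z G\<close>\<close>

definition companion :: "complex set \<Rightarrow> (complex \<Rightarrow> complex) \<Rightarrow> (complex \<Rightarrow> complex) \<Rightarrow> bool" where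
  "companion S G h \<longleftrightarrow>
     (\<exists>G1 G2. \<forall>w\<in>S.
        (G has_field_derivative G1 w) (at w within S) \<and>
        (G1 has_field_derivative G2 w) (at w within S) \<and>
        h w = G2 w - w * G w)"

definition fundamental_system ::
  "'a set \<Rightarrow> (('a \<Rightarrow> complex) \<Rightarrow> bool) \<Rightarrow> ('a \<Rightarrow> complex) \<Rightarrow> ('a \<Rightarrow> complex) \<Rightarrow> ('a \<Rightarrow> complex) \<Rightarrow> bool"
  where
  "fundamental_system S solves f1 f2 f3 \<longleftrightarrow>
     (\<forall>f. solves f \<longleftrightarrow> (\<exists>a1 a2 a3. \<forall>x\<in>S. f x = a1 * f1 x + a2 * f2 x + a3 * f3 x)) \<and>
     (\<forall>a1 a2 a3. (\<forall>x\<in>S. a1 * f1 x + a2 * f2 x + a3 * f3 x = 0) \<longrightarrow> a1 = 0 \<and> a2 = 0 \<and> a3 = 0)"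


section \<open>Adjoint line states\<close>

definition line_U :: "(real \<Rightarrow> real \<Rightarrow> complex) \<Rightarrow> real \<Rightarrow> complex" where
  "line_U u X = set_lebesgue_integral lborel {0<..} (\<lambda>Y. u X Y)"

definition line_b :: "(real \<Rightarrow> real \<Rightarrow> complex) \<Rightarrow> real \<Rightarrow> complex" where
  "line_b u X = vector_derivative (line_U u) (at X)"

text \<open>The operator \<open>H\<partial>\<^sub>X\<close> is any operator on functions of \<open>X\<close> with Fourier symbol \<open>\<bar>k\<bar>\<close>.\<close>

definition has_fourier_symbol ::
  "((real \<Rightarrow> complex) \<Rightarrow> (real \<Rightarrow> complex)) \<Rightarrow> (real \<Rightarrow> complex) \<Rightarrow> bool" where
  "has_fourier_symbol T \<sigma> \<longleftrightarrow>
     (\<forall>k A. T (\<lambda>X. A * plane_wave (of_real k) X) = (\<lambda>X. \<sigma> k * (A * plane_wave (of_real k) X)))"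

definition line_mu ::
  "((real \<Rightarrow> complex) \<Rightarrow> (real \<Rightarrow> complex)) \<Rightarrow> (real \<Rightarrow> real \<Rightarrow> complex) \<Rightarrow> real \<Rightarrow> complex" where
  "line_mu HD u = HD (line_b u)"

end

theory Submission
  imports Defs "HOL-Real_Asymp.Real_Asymp"
begin

text \<open>
  If \<open>h = G'' - z G\<close> for a solution \<open>G\<close> of the third-order equation, then \<open>h' = G\<close>, so
  \<open>h'' - z h\<close> is a constant \<open>r\<close> and \<open>h + \<pi> r Gi\<close> solves the Airy equation; constancy of the
  Wronskians with \<open>Ai\<close> and \<open>Bi\<close> then expresses \<open>h\<close>, hence \<open>G\<close>, in the basis. The argument needs
  only a convex domain, so it covers the plane and the ray at once.

  The behaviour at infinity comes from the integrals of \<open>exp (z t - t\<^sup>3/3)\<close> over half-lines. They solve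
  \<open>f'' - z f = 1\<close>, so \<open>Ai\<close> and \<open>Gi\<close> are identified with combinations of two of them by their values
  at 0. Contours are moved without Cauchy's theorem: the derivative of such an integral with respect to the
  direction or the vertex of the half-line is the integral of a total derivative. Rotating the
  half-lines so that \<open>Re (z t) < 0\<close> gives the algebraic decay of \<open>Gi\<close>; moving their common vertex
  to a saddle point gives the exponential decay of \<open>Ai\<close>. Finally \<open>Bi\<close> is not admissible, since the
  Wronskian of \<open>Ai\<close> and \<open>Bi\<close> would tend to 0.
\<close>

section \<open>The Airy equation and the third-order equation\<close>

text \<open>One sector governs every use of the integrals. \<open>airy_sector\<close> is |arg d| <
  pi/6, where \<open>Re (d ^ 3) > 0\<close>, so the integrals converge absolutely in these
  directions and in their rotations by cube roots of unity. The cut in \<alpha> keeps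
  \<open>\<i> * \<alpha> * l\<close> off the nonpositive reals, so its principal sixth root \<gamma>
  lies in the same sector and \<open>c = \<gamma>\<^sup>2\<close> has |arg c| < pi/3. Both decay
  arguments live on this: the directions \<open>omega\<close> and \<open>cnj omega\<close> can be
  turned until \<open>Re (c * d) < 0\<close>, and for \<open>p = \<gamma> * sqrt Y\<close> the
  quadratic term of the exponent at the saddle point \<open>- p\<close> does no harm. Turning
  half-lines alone would not make \<open>Ai\<close> exponentially small: each integral is asymptotic
  to -1/z, and their difference merely loses this leading term. Hence the second deformation. On the
  side of the equations, functions of \<open>Y\<close> are given only for \<open>Y > 0\<close>, so
  nothing is holomorphic a priori; the equation in \<open>z\<close> is read with derivatives within
  a ray, and the linear ODE theory is set up for such derivatives.\<close>

lemma airy_DERIV: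
  "(Ai has_field_derivative deriv Ai z) (at z within S)"
  "(Bi has_field_derivative deriv Bi z) (at z within S)"
  "(Gi has_field_derivative deriv Gi z) (at z within S)"
  "(deriv Ai has_field_derivative z * Ai z) (at z within S)"
  "(deriv Bi has_field_derivative z * Bi z) (at z within S)"
  "(deriv Gi has_field_derivative z * Gi z - 1 / of_real pi) (at z within S)"
proof -
  have "(airy_ivp r a b has_field_derivative deriv (airy_ivp r a b) z) (at z within S)" for r a b
    using airy_ivp_has_deriv[of r a b z]
    by (auto simp: deriv_airy_ivp intro: has_field_derivative_at_within)
  then show "(Ai has_field_derivative deriv Ai z) (at z within S)"
    "(Bi has_field_derivative deriv Bi z) (at z within S)"
    "(Gi has_field_derivative deriv Gi z) (at z within S)"
    unfolding Ai_def Bi_def Gi_def by auto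
qed (auto intro: has_field_derivative_at_within Airy_ode)

definition airy_wronskian :: complex where
  "airy_wronskian = Ai 0 * deriv Bi 0 - deriv Ai 0 * Bi 0"

lemma airy_wronskian: "Ai z * deriv Bi z - deriv Ai z * Bi z = airy_wronskian"
proof -
  have "((\<lambda>z. Ai z * deriv Bi z - deriv Ai z * Bi z) has_field_derivative 0) (at x within UNIV)" for x
    by (auto intro!: derivative_eq_intros airy_DERIV)
  then have "\<exists>k. \<forall>z\<in>UNIV. Ai z * deriv Bi z - deriv Ai z * Bi z = k"
    by (intro has_field_derivative_zero_constant) auto
  then obtain k where "\<And>z. Ai z * deriv Bi z - deriv Ai z * Bi z = k" by blast
  then show ?thesis by (simp add: airy_wronskian_def)
qed

text \<open>Of the four values at 0 only \<open>deriv Ai 0\<close> is negative, so the two terms of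
  the Wronskian add up instead of cancelling.\<close>

lemma airy_wronskian_nonzero: "airy_wronskian \<noteq> 0"
proof -
  define x y where "x = 1 / (3 powr (2/3) * Gamma (2/3 :: real))"
    and "y = 1 / (3 powr (1/3) * Gamma (1/3 :: real))"
  define x' y' where "x' = 1 / (3 powr (1/6) * Gamma (2/3 :: real))"
    and "y' = 3 powr (1/6) / Gamma (1/3 :: real)"
  have "x > 0" "y > 0" "x' > 0" "y' > 0"
    unfolding x_def y_def x'_def y'_def by (auto intro!: divide_pos_pos mult_pos_pos Gamma_real_pos)
  then have "x * y' + y * x' > 0" by (auto intro!: add_pos_pos mult_pos_pos)
  moreover have "airy_wronskian = of_real (x * y' + y * x')"
    unfolding airy_wronskian_def Ai_def Bi_def airy_ivp_0 deriv_airy_ivp_0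
    by (simp add: x_def y_def x'_def y'_def)
  ultimately show ?thesis by (metis of_real_eq_0_iff less_irrefl)
qed

text \<open>\<open>F\<close> and its derivative \<open>G\<close> are expanded with the same
  coefficients, because in \<open>third_order_span\<close> the role of \<open>F\<close> falls to the
  companion and that of \<open>G\<close> to the unknown itself.\<close>

lemma airy_equation_span:
  assumes S: "convex S"
    and F: "\<And>w. w \<in> S \<Longrightarrow> (F has_field_derivative G w) (at w within S)"
    and G: "\<And>w. w \<in> S \<Longrightarrow> (G has_field_derivative w * F w + r) (at w within S)"
  obtains a b where
    "\<And>w. w \<in> S \<Longrightarrow> F w = a * Ai w + b * Bi w + (- of_real pi * r) * Gi w"
    "\<And>w. w \<in> S \<Longrightarrow> G w = a * deriv Ai w + b * deriv Bi w + (- of_real pi * r) * deriv Gi w"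
proof -
  define u v where "u w = F w + of_real pi * r * Gi w"
    and "v w = G w + of_real pi * r * deriv Gi w" for w
  have u: "(u has_field_derivative v w) (at w within S)" if "w \<in> S" for w
    unfolding u_def v_def by (auto intro!: derivative_eq_intros F that airy_DERIV)
  have v: "(v has_field_derivative w * u w) (at w within S)" if "w \<in> S" for w
    unfolding u_def v_def
    by (rule derivative_eq_intros G that airy_DERIV refl)+ (simp add: algebra_simps)
  have "\<exists>P. \<forall>w\<in>S. u w * deriv Bi w - v w * Bi w = P"
    by (rule has_field_derivative_zero_constant[OF S])
      (auto intro!: derivative_eq_intros airy_DERIV u v)
  then obtain P where P: "\<And>w. w \<in> S \<Longrightarrow> u w * deriv Bi w - v w * Bi w = P" by blast
  have "\<exists>P. \<forall>w\<in>S. u w * deriv Ai w - v w * Ai w = P"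
    by (rule has_field_derivative_zero_constant[OF S])
      (auto intro!: derivative_eq_intros airy_DERIV u v)
  then obtain Q where Q: "\<And>w. w \<in> S \<Longrightarrow> u w * deriv Ai w - v w * Ai w = Q" by blast
  show thesis
  proof (rule that[of "P / airy_wronskian" "- Q / airy_wronskian"])
    fix w assume w: "w \<in> S"
    \<comment> \<open>Cramer's rule for the coordinates of \<open>(u, v)\<close> with respect to
      \<open>(Ai, deriv Ai)\<close> and \<open>(Bi, deriv Bi)\<close>.\<close>
    have "u w * airy_wronskian = P * Ai w - Q * Bi w"
      unfolding P[OF w, symmetric] Q[OF w, symmetric] airy_wronskian[of w, symmetric]
      by (simp add: algebra_simps)
    then show "F w = P / airy_wronskian * Ai w + - Q / airy_wronskian * Bi w
        + (- of_real pi * r) * Gi w"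
      using airy_wronskian_nonzero by (simp add: u_def field_simps)
    have "v w * airy_wronskian = P * deriv Ai w - Q * deriv Bi w"
      unfolding P[OF w, symmetric] Q[OF w, symmetric] airy_wronskian[of w, symmetric]
      by (simp add: algebra_simps)
    then show "G w = P / airy_wronskian * deriv Ai w + - Q / airy_wronskian * deriv Bi w
        + (- of_real pi * r) * deriv Gi w"
      using airy_wronskian_nonzero by (simp add: v_def field_simps)
  qed
qed

text \<open>The difference from the series solution is a combination of \<open>Ai\<close> and
  \<open>Bi\<close> with zero Cauchy data at 0, and the Wronskian forces both coefficients to
  vanish.\<close>

lemma airy_ivp_unique:
  assumes F: "\<And>w. (F has_field_derivative G w) (at w)"
    and G: "\<And>w. (G has_field_derivative w * F w + r) (at w)"
  shows "F = airy_ivp r (F 0) (G 0)"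
proof
  fix w
  let ?f = "airy_ivp r (F 0) (G 0)"
  define u v where "u w = F w - ?f w" and "v w = G w - deriv ?f w" for w
  have f: "(?f has_field_derivative deriv ?f w) (at w)" for w
    using airy_ivp_has_deriv[of r "F 0" "G 0" w] by (simp add: deriv_airy_ivp)
  have u: "(u has_field_derivative v w) (at w within UNIV)" for w
    unfolding u_def v_def by (auto intro!: derivative_eq_intros F f)
  have v: "(v has_field_derivative w * u w + 0) (at w within UNIV)" for w
    unfolding u_def v_def
    by (rule derivative_eq_intros G airy_ivp_ode refl)+ (simp add: algebra_simps)
  obtain a b where u': "\<And>w. u w = a * Ai w + b * Bi w"
      and v': "\<And>w. v w = a * deriv Ai w + b * deriv Bi w"
    using airy_equation_span[of UNIV u v 0] u v by auto
  have 0: "a * Ai 0 + b * Bi 0 = 0" "a * deriv Ai 0 + b * deriv Bi 0 = 0"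
    unfolding u'[symmetric] v'[symmetric] by (simp_all add: u_def v_def airy_ivp_0 deriv_airy_ivp_0)
  have "a * airy_wronskian = (a * Ai 0 + b * Bi 0) * deriv Bi 0 - (a * deriv Ai 0 + b * deriv Bi 0) * Bi 0"
    "b * airy_wronskian = (a * deriv Ai 0 + b * deriv Bi 0) * Ai 0 - (a * Ai 0 + b * Bi 0) * deriv Ai 0"
    by (simp_all add: airy_wronskian_def algebra_simps)
  then have "a = 0" "b = 0" unfolding 0 using airy_wronskian_nonzero by auto
  then show "F w = ?f w" using u'[of w] by (simp add: u_def)
qed

lemma third_order_span:
  assumes S: "convex S"
    and G: "\<And>w. w \<in> S \<Longrightarrow> (G has_field_derivative G1 w) (at w within S)"
      "\<And>w. w \<in> S \<Longrightarrow> (G1 has_field_derivative G2 w) (at w within S)"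
      "\<And>w. w \<in> S \<Longrightarrow> (G2 has_field_derivative G3 w) (at w within S)"
      "\<And>w. w \<in> S \<Longrightarrow> G3 w - w * G1 w - 2 * G w = 0"
  shows "\<exists>a1 a2 a3. \<forall>w\<in>S. G w = a1 * deriv Ai w + a2 * deriv Bi w + a3 * deriv Gi w
      \<and> G2 w - w * G w = a1 * Ai w + a2 * Bi w + a3 * Gi w"
proof -
  define H where "H w = G2 w - w * G w" for w
  have H: "(H has_field_derivative G w) (at w within S)" if "w \<in> S" for w
    unfolding H_def using G(4)[OF that]
    by (auto intro!: derivative_eq_intros G that simp: algebra_simps)
  \<comment> \<open>As \<open>H\<close> has derivative \<open>G\<close>, the quantity
    \<open>G1 - w H\<close> is \<open>H'' - w H\<close>; its derivative \<open>G2 - H - w G\<close>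
    is 0 by the choice of \<open>H\<close>.\<close>
  have "\<exists>r. \<forall>w\<in>S. G1 w - w * H w = r"
    by (rule has_field_derivative_zero_constant[OF S])
      (rule derivative_eq_intros H G(2) refl | assumption | simp add: H_def)+
  then obtain r where r: "\<And>w. w \<in> S \<Longrightarrow> G1 w = w * H w + r"
    by (metis add.commute diff_add_cancel)
  have "(G has_field_derivative w * H w + r) (at w within S)" if "w \<in> S" for w
    using G(1)[OF that] r[OF that] by simp
  from airy_equation_span[OF S H this] obtain a b where
    "\<And>w. w \<in> S \<Longrightarrow> H w = a * Ai w + b * Bi w + (- of_real pi * r) * Gi w"
    "\<And>w. w \<in> S \<Longrightarrow> G w = a * deriv Ai w + b * deriv Bi w + (- of_real pi * r) * deriv Gi w"
    by blast
  then show ?thesis unfolding H_def by blast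
qed

text \<open>These closed forms are the witnesses for the existential derivatives in
  \<open>reduced_equation_z\<close> and \<open>companion\<close>. The constant
  \<open>a3 / pi\<close> in \<open>G1\<close> is the inhomogeneity contributed by
  \<open>Gi\<close>.\<close>

lemma third_order_combination:
  assumes "\<And>w. G w = a1 * deriv Ai w + a2 * deriv Bi w + a3 * deriv Gi w"
    and "\<And>w. h w = a1 * Ai w + a2 * Bi w + a3 * Gi w"
  defines "G1 \<equiv> \<lambda>w. w * h w - a3 / of_real pi"
  shows "(h has_field_derivative G w) (at w within S)"
    and "(G has_field_derivative G1 w) (at w within S)"
    and "(G1 has_field_derivative h w + w * G w) (at w within S)"
    and "((\<lambda>w. h w + w * G w) has_field_derivative 2 * G w + w * G1 w) (at w within S)"
proof -
  have G_eq: "G = (\<lambda>w. a1 * deriv Ai w + a2 * deriv Bi w + a3 * deriv Gi w)"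
    and h_eq: "h = (\<lambda>w. a1 * Ai w + a2 * Bi w + a3 * Gi w)"
    using assms by auto
  show h: "(h has_field_derivative G w) (at w within S)"
    unfolding G_eq h_eq by (auto intro!: derivative_eq_intros airy_DERIV)
  show G: "(G has_field_derivative G1 w) (at w within S)"
    unfolding G1_def unfolding G_eq h_eq
    by (rule derivative_eq_intros airy_DERIV refl)+ (simp add: algebra_simps)
  show "(G1 has_field_derivative h w + w * G w) (at w within S)"
    unfolding G1_def by (auto intro!: derivative_eq_intros h)
  show "((\<lambda>w. h w + w * G w) has_field_derivative 2 * G w + w * G1 w) (at w within S)"
    by (auto intro!: derivative_eq_intros h G)
qed

text \<open>The hypothesis on limit points makes derivatives within \<open>S\<close> unique.\<close>

lemma airy_deriv_independent:
  assumes "S \<noteq> {}" and S: "\<And>w. w \<in> S \<Longrightarrow> at w within S \<noteq> bot"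
    and 0: "\<And>w. w \<in> S \<Longrightarrow> a1 * deriv Ai w + a2 * deriv Bi w + a3 * deriv Gi w = 0"
  shows "a1 = 0 \<and> a2 = 0 \<and> a3 = 0"
proof -
  define h G where "h w = a1 * Ai w + a2 * Bi w + a3 * Gi w"
    and "G w = a1 * deriv Ai w + a2 * deriv Bi w + a3 * deriv Gi w" for w
  note deriv = third_order_combination[of G a1 a2 a3 h, OF G_def h_def, where S = S]
  have zero: "D = 0" if "(f has_field_derivative D) (at w within S)" "\<And>w. w \<in> S \<Longrightarrow> f w = 0" "w \<in> S"
    for f D w
  proof -
    have "(f has_field_derivative 0) (at w within S) \<longleftrightarrow> ((\<lambda>_. 0) has_field_derivative 0) (at w within S)"
      using that by (intro has_field_derivative_cong_eventually) (auto simp: eventually_at_filter)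
    then have "(f has_field_derivative 0) (at w within S)" by simp
    with that(1) show ?thesis using S[OF that(3)] has_field_derivative_unique by blast
  qed
  have G0: "G w = 0" if "w \<in> S" for w using 0[OF that] by (simp add: G_def)
  \<comment> \<open>Two differentiations of the vanishing combination within \<open>S\<close>: the
    first gives \<open>w h = a3 / pi\<close>, the second \<open>h = 0\<close>, so
    \<open>a3 = 0\<close>. The Wronskian then settles \<open>a1\<close> and
    \<open>a2\<close>.\<close>
  have G1: "w * h w - a3 / of_real pi = 0" if "w \<in> S" for w
    using zero[OF deriv(2)[of w] G0 that] .
  have h: "h w = 0" if "w \<in> S" for w
    using zero[OF deriv(3)[of w] G1 that] G0[OF that] by simp
  obtain w where w: "w \<in> S" using assms(1) by auto
  have a3: "a3 = 0" using G1[OF w] h[OF w] by simp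
  have *: "a1 * Ai w + a2 * Bi w = 0" "a1 * deriv Ai w + a2 * deriv Bi w = 0"
    using h[OF w] G0[OF w] by (simp_all add: h_def G_def a3)
  have "a1 * airy_wronskian = (a1 * Ai w + a2 * Bi w) * deriv Bi w - (a1 * deriv Ai w + a2 * deriv Bi w) * Bi w"
    "a2 * airy_wronskian = (a1 * deriv Ai w + a2 * deriv Bi w) * Ai w - (a1 * Ai w + a2 * Bi w) * deriv Ai w"
    by (simp_all add: airy_wronskian[of w, symmetric] algebra_simps)
  then show ?thesis unfolding * using airy_wronskian_nonzero a3 by auto
qed

section \<open>Integrals of exponentials of cubics\<close>

text \<open>The mean value inequality on the ball bounds every difference quotient by the same
  \<open>g\<close> that bounds the derivative, so dominated convergence applies along any sequence
  that tends to \<open>z0\<close>.\<close>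

lemma has_field_derivative_integral_dominated:
  fixes f f' :: "complex \<Rightarrow> 'a \<Rightarrow> complex"
  assumes "r > 0"
    and int: "\<And>z. z \<in> ball z0 r \<Longrightarrow> integrable M (f z)"
    and meas: "f' z0 \<in> borel_measurable M"
    and deriv: "\<And>z s. z \<in> ball z0 r \<Longrightarrow> s \<in> space M \<Longrightarrow>
      ((\<lambda>z. f z s) has_field_derivative f' z s) (at z)"
    and bound: "\<And>z s. z \<in> ball z0 r \<Longrightarrow> s \<in> space M \<Longrightarrow> norm (f' z s) \<le> g s"
    and g: "integrable M g"
  shows "((\<lambda>z. integral\<^sup>L M (f z)) has_field_derivative integral\<^sup>L M (f' z0)) (at z0)"
  unfolding has_field_derivative_iff tendsto_at_iff_sequentially comp_def
proof safe
  fix X :: "nat \<Rightarrow> complex"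
  assume X: "\<forall>i. X i \<in> UNIV - {z0}" "X \<longlonglongrightarrow> z0"
  obtain N where N: "\<And>n. n \<ge> N \<Longrightarrow> X n \<in> ball z0 r"
    using metric_LIMSEQ_D[OF X(2) \<open>r > 0\<close>] by (auto simp: dist_commute)
  have z0: "z0 \<in> ball z0 r" using \<open>r > 0\<close> by simp
  \<comment> \<open>The shift by \<open>N\<close> drops the terms of the sequence that lie outside
    the ball.\<close>
  define Q where "Q n s = (f (X (n + N)) s - f z0 s) / (X (n + N) - z0)" for n s
  have "(\<lambda>n. integral\<^sup>L M (Q n)) \<longlonglongrightarrow> integral\<^sup>L M (f' z0)"
  proof (rule integral_dominated_convergence[where w = g])
    show "Q n \<in> borel_measurable M" for n
      unfolding Q_def using int[OF N[of "n + N"]] int[OF z0] by simp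
    have lim: "(\<lambda>n. Q n s) \<longlonglongrightarrow> f' z0 s" if s: "s \<in> space M" for s
    proof -
      have "((\<lambda>y. (f y s - f z0 s) / (y - z0)) \<longlongrightarrow> f' z0 s) (at z0)"
        using deriv[OF z0 s] by (simp add: has_field_derivative_iff)
      then have "(\<lambda>n. (f (X n) s - f z0 s) / (X n - z0)) \<longlonglongrightarrow> f' z0 s"
        using X unfolding tendsto_at_iff_sequentially comp_def by blast
      then show ?thesis unfolding Q_def by (rule LIMSEQ_ignore_initial_segment)
    qed
    then show "AE s in M. (\<lambda>n. Q n s) \<longlonglongrightarrow> f' z0 s" by simp
    have "norm (Q n s) \<le> g s" if s: "s \<in> space M" for n s
    proof -
      have "norm (f (X (n + N)) s - f z0 s) \<le> g s * norm (X (n + N) - z0)"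
        by (rule field_differentiable_bound[OF convex_ball, of z0 r "\<lambda>z. f z s" "\<lambda>z. f' z s"])
          (use deriv bound N z0 s in \<open>auto intro: has_field_derivative_at_within\<close>)
      moreover have "X (n + N) \<noteq> z0" using X(1) by auto
      ultimately show ?thesis by (simp add: Q_def norm_divide divide_le_eq)
    qed
    then show "AE s in M. norm (Q n s) \<le> g s" for n by simp
  qed (use meas g in auto)
  moreover have "integral\<^sup>L M (Q n) =
      (integral\<^sup>L M (f (X (n + N))) - integral\<^sup>L M (f z0)) / (X (n + N) - z0)" for n
    unfolding Q_def using int[OF N[of "n + N"]] int[OF z0] by simp
  ultimately show "(\<lambda>n. (integral\<^sup>L M (f (X n)) - integral\<^sup>L M (f z0)) / (X n - z0))
      \<longlonglongrightarrow> integral\<^sup>L M (f' z0)"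
    by (simp add: LIMSEQ_offset[where k = N])
qed

section \<open>Integration over the positive half-line\<close>

lemma einterval_0_infinity: "einterval 0 \<infinity> = {0<..}"
  by (auto simp: einterval_def)

lemma set_integral_FTC_Ioi:
  fixes f F :: "real \<Rightarrow> 'a :: euclidean_space"
  assumes "\<And>x. x > 0 \<Longrightarrow> (F has_vector_derivative f x) (at x)"
    and "\<And>x. x > 0 \<Longrightarrow> isCont f x"
    and "set_integrable lborel {0<..} f"
    and "(F \<longlongrightarrow> A) (at_right 0)" and "(F \<longlongrightarrow> B) at_top"
  shows "set_lebesgue_integral lborel {0<..} f = B - A"
proof -
  have "(LBINT x=0..\<infinity>. f x) = B - A"
    by (rule interval_integral_FTC_integrable[where F = F])
      (use assms in \<open>auto simp: einterval_0_infinity ereal_tendsto_simps zero_ereal_def\<close>)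
  then show ?thesis by (simp add: interval_lebesgue_integral_0_infty)
qed

lemma exp_minus_Ioi:
  assumes "\<rho> > 0"
  shows "set_integrable lborel {0<..} (\<lambda>s::real. exp (- \<rho> * s))"
    and "(LINT s:{0<..}|lborel. exp (- \<rho> * s)) = 1 / \<rho>"
proof -
  define F where "F s = - exp (- \<rho> * s) / \<rho>" for s :: real
  have F: "DERIV F s :> exp (- \<rho> * s)" for s
    unfolding F_def using assms by (auto intro!: derivative_eq_intros)
  have "isCont F 0" using F by (rule DERIV_isCont)
  then have F0: "(F \<longlongrightarrow> - 1 / \<rho>) (at_right 0)"
    using filterlim_at_split by (fastforce simp: isCont_def F_def)
  have Finf: "(F \<longlongrightarrow> 0) at_top"
    unfolding F_def using assms by real_asymp
  have "set_integrable lborel (einterval 0 \<infinity>) (\<lambda>s. exp (- \<rho> * s))"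
    "(LBINT s=0..\<infinity>. exp (- \<rho> * s)) = 0 - (- 1 / \<rho>)"
    using F0 Finf F
    by (intro interval_integral_FTC_nonneg[where F = F]; auto simp: ereal_tendsto_simps zero_ereal_def)+
  then show "set_integrable lborel {0<..} (\<lambda>s::real. exp (- \<rho> * s))"
    "(LINT s:{0<..}|lborel. exp (- \<rho> * s)) = 1 / \<rho>"
    by (simp_all add: einterval_0_infinity interval_lebesgue_integral_0_infty)
qed

text \<open>A single term of the exponential series is at most its sum.\<close>

lemma power_times_exp_le:
  fixes s \<rho> :: real
  assumes "s \<ge> 0" "\<rho> > 0"
  shows "s ^ k \<le> fact k / \<rho> ^ k * exp (\<rho> * s)"
proof -
  have "(\<rho> * s) ^ k / fact k \<le> exp (\<rho> * s)"
    using assms sum_le_suminf[OF summable_exp_generic[of "\<rho> * s"], of "{k}"]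
    by (simp add: exp_def scaleR_conv_of_real field_simps)
  then show ?thesis using assms by (simp add: field_simps power_mult_distrib)
qed

lemma set_integrable_Ioi_bound:
  fixes f :: "real \<Rightarrow> 'a :: euclidean_space" and g :: "real \<Rightarrow> real"
  assumes "set_integrable lborel {0<..} g" and "continuous_on {0<..} f"
    and "\<And>s. s > 0 \<Longrightarrow> norm (f s) \<le> g s"
  shows "set_integrable lborel {0<..} f"
  unfolding set_integrable_def
proof (rule Bochner_Integration.integrable_bound)
  show "integrable lborel (\<lambda>s. indicat_real {0<..} s *\<^sub>R g s)"
    using assms(1) by (simp add: set_integrable_def)
  show "(\<lambda>s. indicat_real {0<..} s *\<^sub>R f s) \<in> borel_measurable lborel"
    using borel_measurable_continuous_on_indicator[OF _ assms(2)] by simp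
  show "AE s in lborel. norm (indicat_real {0<..} s *\<^sub>R f s) \<le> norm (indicat_real {0<..} s *\<^sub>R g s)"
    using assms(3) by (intro AE_I2) (force simp: indicator_def)
qed

lemma power_times_cubic_exp_integrable:
  fixes \<eta> K L :: real
  assumes "\<eta> > 0"
  shows "set_integrable lborel {0<..} (\<lambda>s. s ^ k * exp (- \<eta> * s ^ 3 + K * s ^ 2 + L * s))"
proof -
  \<comment> \<open>Of the two extra units in the linear rate, one pays for \<open>s ^ k\<close> and
    the other leaves the integrable majorant \<open>exp (- s)\<close>.\<close>
  define L' where "L' = L + 2"
  \<comment> \<open>Beyond \<open>T\<close> the cubic term dominates, since
    \<open>\<eta> * T\<close> exceeds the sum of the other coefficients and \<open>T \<ge> 1\<close>
    gives \<open>s \<le> s ^ 2\<close>. Below \<open>T\<close> the exponent is bounded by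
    \<open>C\<close>.\<close>
  define T where "T = 1 + (\<bar>K\<bar> + \<bar>L'\<bar>) / \<eta>"
  have T: "T \<ge> 1" "(\<bar>K\<bar> + \<bar>L'\<bar>) \<le> \<eta> * T" using assms by (auto simp: T_def field_simps)
  define C where "C = (\<bar>K\<bar> + \<bar>L'\<bar>) * T ^ 2"
  have C: "- \<eta> * s ^ 3 + K * s ^ 2 + L' * s \<le> C" if s: "s > 0" for s
  proof (cases "s \<ge> T")
    case True
    have "K * s ^ 2 + L' * s \<le> \<bar>K\<bar> * s ^ 2 + \<bar>L'\<bar> * s ^ 2"
      using s True T
      by (intro add_mono mult_mono) (auto simp: power2_eq_square)
    also have "\<dots> = (\<bar>K\<bar> + \<bar>L'\<bar>) * s ^ 2" by (simp add: algebra_simps)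
    also have "\<dots> \<le> (\<eta> * s) * s ^ 2"
    proof (intro mult_right_mono)
      show "\<bar>K\<bar> + \<bar>L'\<bar> \<le> \<eta> * s"
        using T(2) True assms by (meson less_imp_le mult_left_mono order_trans)
    qed auto
    also have "\<dots> = \<eta> * s ^ 3" by (simp add: power3_eq_cube power2_eq_square)
    finally have "- \<eta> * s ^ 3 + K * s ^ 2 + L' * s \<le> 0" by simp
    also have "0 \<le> C" by (simp add: C_def)
    finally show ?thesis .
  next
    case False
    have "K * s ^ 2 \<le> \<bar>K\<bar> * T ^ 2"
      using s False by (intro mult_mono power_mono) auto
    moreover have "L' * s \<le> \<bar>L'\<bar> * T ^ 2"
    proof (intro mult_mono)
      have "T \<le> T * T" using T by simp
      then show "s \<le> T ^ 2" using False by (simp add: power2_eq_square)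
    qed (use s in auto)
    moreover have "0 \<le> \<eta> * s ^ 3" using assms s by simp
    ultimately show ?thesis by (simp add: C_def algebra_simps)
  qed
  have int: "set_integrable lborel {0<..} (\<lambda>s. (fact k * exp C) * exp (- 1 * s))"
    using exp_minus_Ioi(1)[of 1] by (intro set_integrable_mult_right) simp_all
  have bound: "norm (s ^ k * exp (- \<eta> * s ^ 3 + K * s ^ 2 + L * s)) \<le> (fact k * exp C) * exp (- 1 * s)"
    if s: "s > 0" for s
  proof -
    have "norm (s ^ k * exp (- \<eta> * s ^ 3 + K * s ^ 2 + L * s)) =
        s ^ k * exp (- \<eta> * s ^ 3 + K * s ^ 2 + L * s)"
      using s by simp
    also have "\<dots> \<le> (fact k * exp s) * exp (C - 2 * s)"
      using power_times_exp_le[of s 1 k] C[OF s] s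
      by (intro mult_mono) (auto simp: L'_def algebra_simps)
    also have "\<dots> = (fact k * exp C) * exp (- 1 * s)"
      by (simp add: mult_exp_exp algebra_simps)
    finally show ?thesis .
  qed
  show ?thesis
    by (rule set_integrable_Ioi_bound[OF int _ bound]) (intro continuous_intros)
qed

section \<open>Moments of exponentials of cubics\<close>

definition cubic_exp :: "complex \<Rightarrow> complex \<Rightarrow> complex \<Rightarrow> real \<Rightarrow> complex" where
  "cubic_exp a b e s = exp (- a * of_real s ^ 3 + b * of_real s ^ 2 + e * of_real s)"

text \<open>Three free coefficients are kept because rotating a half-line changes \<open>a\<close>
  and \<open>e\<close>, moving its vertex changes \<open>b\<close> and \<open>e\<close>, and varying
  \<open>z\<close> changes \<open>e\<close>. The index \<open>k\<close> counts the powers of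
  \<open>s\<close> that differentiation brings down.\<close>

definition cubic_moment :: "nat \<Rightarrow> complex \<Rightarrow> complex \<Rightarrow> complex \<Rightarrow> complex" where
  "cubic_moment k a b e = (LINT s:{0<..}|lborel. of_real s ^ k * cubic_exp a b e s)"

lemma norm_cubic_exp: "norm (cubic_exp a b e s) = exp (- Re a * s ^ 3 + Re b * s ^ 2 + Re e * s)"
  unfolding cubic_exp_def norm_exp_eq_Re by (simp flip: of_real_power)

lemma norm_cubic_exp_le:
  assumes "s > 0" "Re a \<ge> \<eta>" "Re b \<le> K" "Re e \<le> L"
  shows "norm (cubic_exp a b e s) \<le> exp (- \<eta> * s ^ 3 + K * s ^ 2 + L * s)"
proof -
  have "\<eta> * s ^ 3 \<le> Re a * s ^ 3" "Re b * s ^ 2 \<le> K * s ^ 2" "Re e * s \<le> L * s"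
    using assms by (auto intro!: mult_right_mono)
  then show ?thesis by (simp add: norm_cubic_exp)
qed

lemma cubic_exp_deriv:
  "(cubic_exp a b e has_vector_derivative
     (- 3 * a * of_real s ^ 2 + 2 * b * of_real s + e) * cubic_exp a b e s) (at s)"
proof -
  have "((\<lambda>x. exp (- a * x ^ 3 + b * x ^ 2 + e * x)) has_field_derivative
      (- 3 * a * of_real s ^ 2 + 2 * b * of_real s + e) * cubic_exp a b e s) (at (of_real s))"
    unfolding cubic_exp_def by (auto intro!: derivative_eq_intros simp: algebra_simps)
  from has_vector_derivative_real_field[OF this] show ?thesis
    by (simp add: cubic_exp_def[abs_def] comp_def)
qed

lemma continuous_cubic_exp [continuous_intros]: "continuous_on S (cubic_exp a b e)"
  unfolding cubic_exp_def[abs_def] by (intro continuous_intros)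

lemma cubic_moment_integrable:
  assumes "Re a > 0"
  shows "set_integrable lborel {0<..} (\<lambda>s. of_real s ^ k * cubic_exp a b e s)"
proof (rule set_integrable_Ioi_bound[OF power_times_cubic_exp_integrable[OF assms]])
  show "norm (of_real s ^ k * cubic_exp a b e s) \<le> s ^ k * exp (- Re a * s ^ 3 + Re b * s ^ 2 + Re e * s)"
    if "s > 0" for s
    using that by (simp add: norm_mult norm_power norm_cubic_exp)
qed (intro continuous_intros)

text \<open>The derivatives of \<open>E\<close> and of \<open>s E\<close> are integrated over the
  half-line, with boundary terms \<open>0 - 1\<close> and \<open>0 - 0\<close>. The first identity
  is the source of the inhomogeneity 1 and of the derivative in the vertex; the second makes the
  integrals invariant under rotation.\<close>

lemma cubic_moment_FTC:
  assumes "Re a > 0"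
  shows "- 3 * a * cubic_moment 2 a b e + 2 * b * cubic_moment 1 a b e + e * cubic_moment 0 a b e = - 1"
    and "cubic_moment 0 a b e - 3 * a * cubic_moment 3 a b e + 2 * b * cubic_moment 2 a b e
      + e * cubic_moment 1 a b e = 0"
proof -
  let ?E = "cubic_exp a b e"
  note int = cubic_moment_integrable[OF assms, of _ b e]
  have "((\<lambda>s. exp (- Re a * s ^ 3 + Re b * s ^ 2 + Re e * s)) \<longlongrightarrow> 0) at_top"
    "((\<lambda>s. s * exp (- Re a * s ^ 3 + Re b * s ^ 2 + Re e * s)) \<longlongrightarrow> 0) at_top"
    using assms by real_asymp+
  then have lim: "(?E \<longlongrightarrow> 0) at_top" "((\<lambda>s. of_real s * ?E s) \<longlongrightarrow> 0) at_top"
    using tendsto_rabs_zero_iff[of "\<lambda>s. s * exp (- Re a * s ^ 3 + Re b * s ^ 2 + Re e * s)" at_top]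
      tendsto_norm_zero_iff[of ?E at_top] tendsto_norm_zero_iff[of "\<lambda>s. of_real s * ?E s" at_top]
    by (simp_all add: norm_mult norm_cubic_exp abs_mult)
  have lim0: "((\<lambda>s. of_real s ^ k * ?E s) \<longlongrightarrow> 0 ^ k) (at_right 0)" for k
  proof -
    have "isCont (\<lambda>s. of_real s ^ k * ?E s) 0"
      using continuous_cubic_exp[of UNIV a b e]
      by (auto intro!: continuous_intros simp: continuous_on_eq_continuous_at)
    then have "((\<lambda>s. of_real s ^ k * ?E s) \<longlongrightarrow> 0 ^ k) (at 0)"
      by (simp add: isCont_def cubic_exp_def)
    then show ?thesis by (rule tendsto_within_subset) simp
  qed
  let ?f = "\<lambda>s. (- 3 * a) * (of_real s ^ 2 * ?E s) + (2 * b) * (of_real s ^ 1 * ?E s) + e * (of_real s ^ 0 * ?E s)"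
  have "(LINT s:{0<..}|lborel. ?f s) = 0 - 1"
  proof (rule set_integral_FTC_Ioi[where F = ?E])
    show "(?E has_vector_derivative ?f s) (at s)" for s
      using cubic_exp_deriv[of a b e s] by (simp add: algebra_simps)
    show "isCont ?f s" for s
      by (rule continuous_on_interior[of UNIV]) (auto intro!: continuous_intros)
    show "set_integrable lborel {0<..} ?f"
      by (intro set_integral_add set_integrable_mult_right int)
  qed (use lim lim0[of 0] in simp_all)
  moreover have "(LINT s:{0<..}|lborel. ?f s) =
      - 3 * a * cubic_moment 2 a b e + 2 * b * cubic_moment 1 a b e + e * cubic_moment 0 a b e"
    unfolding cubic_moment_def
    by (subst set_integral_add set_integral_mult_right; (intro set_integral_add set_integrable_mult_right int)?)+ simp
  ultimately show "- 3 * a * cubic_moment 2 a b e + 2 * b * cubic_moment 1 a b e + e * cubic_moment 0 a b e = - 1"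
    by simp
  let ?g = "\<lambda>s. of_real s ^ 0 * ?E s + (- 3 * a) * (of_real s ^ 3 * ?E s) + (2 * b) * (of_real s ^ 2 * ?E s)
     + e * (of_real s ^ 1 * ?E s)"
  have "(LINT s:{0<..}|lborel. ?g s) = 0 - 0"
  proof (rule set_integral_FTC_Ioi[where F = "\<lambda>s. of_real s ^ 1 * ?E s"])
    show "((\<lambda>s. of_real s ^ 1 * ?E s) has_vector_derivative ?g s) (at s)" for s
      by (rule has_vector_derivative_eq_rhs[OF has_vector_derivative_mult[OF _ cubic_exp_deriv]])
        (auto intro!: derivative_eq_intros simp: algebra_simps power2_eq_square power3_eq_cube)
    show "isCont ?g s" for s
      by (rule continuous_on_interior[of UNIV]) (auto intro!: continuous_intros)
    show "set_integrable lborel {0<..} ?g"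
      by (intro set_integral_add set_integrable_mult_right int)
  qed (use lim lim0[of 1] in simp_all)
  moreover have "(LINT s:{0<..}|lborel. ?g s) =
      cubic_moment 0 a b e - 3 * a * cubic_moment 3 a b e + 2 * b * cubic_moment 2 a b e
      + e * cubic_moment 1 a b e"
    unfolding cubic_moment_def
    by (subst set_integral_add set_integral_mult_right; (intro set_integral_add set_integrable_mult_right int)?)+ simp
  ultimately show "cubic_moment 0 a b e - 3 * a * cubic_moment 3 a b e + 2 * b * cubic_moment 2 a b e
      + e * cubic_moment 1 a b e = 0"
    by simp
qed

text \<open>Differentiating the exponent brings down \<open>- a' s^3 + b' s^2 + e' s\<close>, which
  raises the order of the moment. One majorant serves a whole ball around \<open>x\<close>.\<close>

lemma cubic_moment_DERIV:
  assumes U: "open U" "x \<in> U"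
    and deriv: "\<And>z. z \<in> U \<Longrightarrow> (a has_field_derivative a' z) (at z)"
      "\<And>z. z \<in> U \<Longrightarrow> (b has_field_derivative b' z) (at z)"
      "\<And>z. z \<in> U \<Longrightarrow> (e has_field_derivative e' z) (at z)"
    and cont': "continuous_on U a'" "continuous_on U b'" "continuous_on U e'"
    and pos: "\<And>z. z \<in> U \<Longrightarrow> Re (a z) > 0"
  shows "((\<lambda>z. cubic_moment k (a z) (b z) (e z)) has_field_derivative
     (- a' x * cubic_moment (k + 3) (a x) (b x) (e x) + b' x * cubic_moment (k + 2) (a x) (b x) (e x)
       + e' x * cubic_moment (k + 1) (a x) (b x) (e x))) (at x)"
proof -
  obtain r where r: "r > 0" "cball x r \<subseteq> U" using U open_contains_cball_eq by blast
  have "continuous_on U a" "continuous_on U b" "continuous_on U e"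
    using deriv by (auto intro!: DERIV_isCont continuous_at_imp_continuous_on)
  then have cont: "continuous_on (cball x r) a" "continuous_on (cball x r) b" "continuous_on (cball x r) e"
    "continuous_on (cball x r) a'" "continuous_on (cball x r) b'" "continuous_on (cball x r) e'"
    using cont' continuous_on_subset r(2) by blast+
  have bounded: "\<exists>K. \<forall>z\<in>cball x r. norm (f z) \<le> K" if "continuous_on (cball x r) f" for f :: "complex \<Rightarrow> complex"
    using compact_imp_bounded[OF compact_continuous_image[OF that compact_cball]]
    by (auto simp: bounded_iff)
  obtain Kb Ke Ka' Kb' Ke' where K_each:
    "\<forall>z\<in>cball x r. norm (b z) \<le> Kb" "\<forall>z\<in>cball x r. norm (e z) \<le> Ke"
    "\<forall>z\<in>cball x r. norm (a' z) \<le> Ka'" "\<forall>z\<in>cball x r. norm (b' z) \<le> Kb'"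
    "\<forall>z\<in>cball x r. norm (e' z) \<le> Ke'"
    using bounded[OF cont(2)] bounded[OF cont(3)] bounded[OF cont(4)] bounded[OF cont(5)]
      bounded[OF cont(6)] by blast
  define K where "K = Max {Kb, Ke, Ka', Kb', Ke'}"
  have "Kb \<le> K" "Ke \<le> K" "Ka' \<le> K" "Kb' \<le> K" "Ke' \<le> K" by (auto simp: K_def)
  then have K: "norm (b z) \<le> K" "norm (e z) \<le> K" "norm (a' z) \<le> K" "norm (b' z) \<le> K" "norm (e' z) \<le> K"
    if "z \<in> cball x r" for z
    using K_each that by (meson order_trans)+
  \<comment> \<open>Compactness turns the pointwise positivity of \<open>Re (a z)\<close> into a
    uniform bound \<open>\<eta> > 0\<close>, which keeps the majorant \<open>B\<close>
    integrable.\<close>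
  have "\<exists>y\<in>cball x r. \<forall>z\<in>cball x r. Re (a y) \<le> Re (a z)"
    using cont(1) r(1) by (intro continuous_attains_inf continuous_intros) auto
  then obtain y where y: "y \<in> cball x r" "\<forall>z\<in>cball x r. Re (a y) \<le> Re (a z)" by blast
  define \<eta> where "\<eta> = Re (a y)"
  have \<eta>: "\<eta> > 0" using pos y r by (auto simp: \<eta>_def)
  define E where "E z = cubic_exp (a z) (b z) (e z)" for z
  define f' where "f' z s = - a' z * (of_real s ^ (k + 3) * E z s) + b' z * (of_real s ^ (k + 2) * E z s)
      + e' z * (of_real s ^ (k + 1) * E z s)" for z s
  define B where "B s = exp (- \<eta> * s ^ 3 + K * s ^ 2 + K * s)" for s :: real
  define g where "g s = K * (s ^ (k + 3) * B s) + K * (s ^ (k + 2) * B s) + K * (s ^ (k + 1) * B s)" for s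
  have int_f: "set_integrable lborel {0<..} (\<lambda>s. of_real s ^ j * E z s)" if "z \<in> U" for z j
    using cubic_moment_integrable[OF pos[OF that]] by (simp add: E_def)
  have int_f': "set_integrable lborel {0<..} (f' z)" if "z \<in> U" for z
    unfolding f'_def using int_f[OF that] by (intro set_integral_add set_integrable_mult_right)
  have int_g: "set_integrable lborel {0<..} g"
    unfolding g_def B_def
    by (intro set_integral_add set_integrable_mult_right power_times_cubic_exp_integrable[OF \<eta>])
  have "((\<lambda>z. LINT s|lborel. indicat_real {0<..} s *\<^sub>R (of_real s ^ k * E z s)) has_field_derivative
      (LINT s|lborel. indicat_real {0<..} s *\<^sub>R f' x s)) (at x)"
  proof (rule has_field_derivative_integral_dominated[OF r(1)])
    fix z assume z: "z \<in> ball x r"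
    then have zU: "z \<in> U" and zc: "z \<in> cball x r" using r by auto
    show "integrable lborel (\<lambda>s. indicat_real {0<..} s *\<^sub>R (of_real s ^ k * E z s))"
      using int_f[OF zU] by (simp add: set_integrable_def)
    fix s :: real
    have "((\<lambda>z. of_real s ^ k * E z s) has_field_derivative f' z s) (at z)"
      unfolding E_def f'_def cubic_exp_def
      by (rule derivative_eq_intros deriv zU refl)+ (simp add: algebra_simps power_add power2_eq_square power3_eq_cube)
    from DERIV_cmult[OF this, of "of_real (indicat_real {0<..} s)"]
    show "((\<lambda>z. indicat_real {0<..} s *\<^sub>R (of_real s ^ k * E z s)) has_field_derivative
      indicat_real {0<..} s *\<^sub>R f' z s) (at z)"
      by (simp add: scaleR_conv_of_real)
    show "norm (indicat_real {0<..} s *\<^sub>R f' z s) \<le> indicat_real {0<..} s *\<^sub>R g s"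
    proof (cases "s > 0")
      case s: True
      have EB: "norm (E z s) \<le> B s"
        unfolding E_def B_def using K(1,2)[OF zc] y zc
        by (intro norm_cubic_exp_le s) (auto simp: \<eta>_def intro: order_trans[OF complex_Re_le_cmod])
      have "norm (u * (of_real s ^ j * E z s)) \<le> K * (s ^ j * B s)" if "norm u \<le> K" for u j
      proof -
        have "K \<ge> 0" using that norm_ge_zero order_trans by blast
        then have "norm u * (s ^ j * norm (E z s)) \<le> K * (s ^ j * B s)"
          using that EB s by (intro mult_mono) auto
        then show ?thesis using s by (simp add: norm_mult norm_power)
      qed
      note this[of "- a' z" "k + 3"] this[of "b' z" "k + 2"] this[of "e' z" "k + 1"]
      then have "norm (f' z s) \<le> g s"
        unfolding f'_def g_def using K(3-)[OF zc]
        by (intro norm_triangle_le add_mono) simp_all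
      then show ?thesis using s by simp
    qed simp
  next
    show "(\<lambda>s. indicat_real {0<..} s *\<^sub>R f' x s) \<in> borel_measurable lborel"
      using int_f'[OF U(2)] by (auto simp: set_integrable_def)
    show "integrable lborel (\<lambda>s. indicat_real {0<..} s *\<^sub>R g s)"
      using int_g by (simp add: set_integrable_def)
  qed
  moreover have "(LINT s:{0<..}|lborel. f' x s) =
     - a' x * cubic_moment (k + 3) (a x) (b x) (e x) + b' x * cubic_moment (k + 2) (a x) (b x) (e x)
       + e' x * cubic_moment (k + 1) (a x) (b x) (e x)"
    unfolding f'_def cubic_moment_def E_def[symmetric]
    by (subst set_integral_add set_integral_mult_right; (intro set_integral_add set_integrable_mult_right int_f U)?)+ simp
  ultimately show ?thesis
    by (simp add: cubic_moment_def E_def set_lebesgue_integral_def)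
qed

section \<open>Size and special values of the moments\<close>

lemma norm_set_integral_Ioi_le:
  fixes f :: "real \<Rightarrow> 'a :: euclidean_space" and g :: "real \<Rightarrow> real"
  assumes "set_integrable lborel {0<..} g" and "continuous_on {0<..} f"
    and "\<And>s. s > 0 \<Longrightarrow> norm (f s) \<le> g s"
  shows "norm (set_lebesgue_integral lborel {0<..} f) \<le> set_lebesgue_integral lborel {0<..} g"
proof -
  have "set_integrable lborel {0<..} f"
    by (rule set_integrable_Ioi_bound[OF assms])
  with assms(1,3) show ?thesis
    unfolding set_lebesgue_integral_def set_integrable_def
    by (intro Bochner_Integration.integral_norm_bound_integral) (auto simp: indicator_def)
qed

text \<open>The cubic factor has norm at most 1; half of the rate \<open>\<rho>\<close> absorbs
  \<open>s ^ k\<close> and the other half is integrated. The power of \<open>\<rho>\<close> is what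
  yields algebraic decay once the half-line is turned.\<close>

lemma norm_cubic_moment_le:
  assumes "Re a > 0" "\<rho> > 0" "Re e \<le> - \<rho>"
  shows "norm (cubic_moment k a 0 e) \<le> fact k * 2 ^ (k + 1) / \<rho> ^ (k + 1)"
proof -
  define g where "g s = (fact k / (\<rho> / 2) ^ k) * exp (- (\<rho> / 2) * s)" for s
  have "norm (cubic_moment k a 0 e) \<le> set_lebesgue_integral lborel {0<..} g"
    unfolding cubic_moment_def
  proof (rule norm_set_integral_Ioi_le)
    show "set_integrable lborel {0<..} g"
      unfolding g_def using exp_minus_Ioi(1)[of "\<rho> / 2"] assms by (intro set_integrable_mult_right) auto
    fix s :: real assume s: "s > 0"
    have "norm (of_real s ^ k * cubic_exp a 0 e s) = s ^ k * norm (cubic_exp a 0 e s)"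
      using s by (simp add: norm_mult norm_power)
    also have "\<dots> \<le> (fact k / (\<rho> / 2) ^ k * exp (\<rho> / 2 * s)) * exp (- \<rho> * s)"
      using power_times_exp_le[of s "\<rho> / 2" k] s assms norm_cubic_exp_le[of s 0 a 0 0 e "- \<rho>"]
      by (intro mult_mono) auto
    also have "\<dots> = g s" by (simp add: g_def mult_exp_exp algebra_simps)
    finally show "norm (of_real s ^ k * cubic_exp a 0 e s) \<le> g s" .
  qed (intro continuous_intros)
  also have "\<dots> = (fact k / (\<rho> / 2) ^ k) * (2 / \<rho>)"
    unfolding g_def using exp_minus_Ioi(2)[of "\<rho> / 2"] assms by simp
  also have "\<dots> = fact k * 2 ^ (k + 1) / \<rho> ^ (k + 1)"
    by (simp add: power_divide mult_ac)
  finally show ?thesis .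
qed

text \<open>Uniformity in \<open>b\<close> is the point: in the saddle point estimate
  \<open>b\<close> is a multiple of the saddle and so tends to infinity along the ray.\<close>

lemma cubic_moment_bounded:
  assumes "Re a > 0"
  obtains C where "C \<ge> 0" "\<And>b e. Re b \<le> 0 \<Longrightarrow> Re e \<le> L \<Longrightarrow> norm (cubic_moment k a b e) \<le> C"
proof
  define g where "g s = s ^ k * exp (- Re a * s ^ 3 + 0 * s ^ 2 + L * s)" for s :: real
  show "norm (cubic_moment k a b e) \<le> set_lebesgue_integral lborel {0<..} g" if "Re b \<le> 0" "Re e \<le> L" for b e
    unfolding cubic_moment_def
  proof (rule norm_set_integral_Ioi_le)
    show "set_integrable lborel {0<..} g"
      unfolding g_def by (rule power_times_cubic_exp_integrable[OF assms])
    show "norm (of_real s ^ k * cubic_exp a b e s) \<le> g s" if "s > 0" for s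
      using norm_cubic_exp_le[OF that order.refl \<open>Re b \<le> 0\<close> \<open>Re e \<le> L\<close>, of a] that
      by (auto simp: g_def norm_mult norm_power intro!: mult_left_mono)
  qed (intro continuous_intros)
  show "set_lebesgue_integral lborel {0<..} g \<ge> 0"
    unfolding set_lebesgue_integral_def by (intro integral_nonneg_AE AE_I2) (auto simp: g_def indicator_def)
qed

text \<open>The substitution \<open>t = s^3/3\<close> turns the moment into Euler's
  integral.\<close>

lemma cubic_moment_Gamma:
  assumes "k < 2"
  shows "cubic_moment k (1/3) 0 0 = of_real (Gamma ((k + 1) / 3) / 3 powr (1 - (k + 1) / 3))"
proof -
  define x where "x = (real k + 1) / 3"
  have x: "x > 0" by (simp add: x_def)
  define f where "f t = t powr (x - 1) / exp t" for t :: real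
  have f: "(f has_integral Gamma x) {0<..}"
  proof -
    have "(f has_integral Gamma x) {0..} \<longleftrightarrow> (f has_integral Gamma x) {0<..}"
      by (rule has_integral_spike_set_eq; rule negligible_subset[of "{0}"]) auto
    then show ?thesis using Gamma_integral_real[OF x] by (simp add: f_def[abs_def])
  qed
  have img: "(\<lambda>s. s ^ 3 / 3) ` {0<..} = {0 :: real<..}"
  proof safe
    fix t :: real assume "t > 0"
    then have "t = root 3 (3 * t) ^ 3 / 3" "root 3 (3 * t) > 0" by simp_all
    then show "t \<in> (\<lambda>s. s ^ 3 / 3) ` {0<..}" by blast
  qed simp
  have "f absolutely_integrable_on {0<..} \<and> integral {0<..} f = Gamma x"
    using f by (auto intro!: nonnegative_absolutely_integrable_1 integral_unique simp: f_def)
  moreover have "inj_on (\<lambda>s. s ^ 3 / 3) {0 :: real<..}"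
    by (auto simp: inj_on_def power_eq_iff_eq_base)
  ultimately have "(\<lambda>s. \<bar>s ^ 2\<bar> * f (s ^ 3 / 3)) absolutely_integrable_on {0<..}
      \<and> integral {0<..} (\<lambda>s. \<bar>s ^ 2\<bar> * f (s ^ 3 / 3)) = Gamma x"
    using has_absolute_integral_change_of_variables_1'[of "{0<..}" "\<lambda>s. s ^ 3 / 3" "\<lambda>s. s ^ 2" f "Gamma x"]
    unfolding img by (fastforce intro!: derivative_eq_intros)
  then have "integral {0<..} (\<lambda>s. \<bar>s ^ 2\<bar> * f (s ^ 3 / 3)) = Gamma x" ..
  also have "integral {0<..} (\<lambda>s. \<bar>s ^ 2\<bar> * f (s ^ 3 / 3)) =
      integral {0<..} (\<lambda>s. 3 powr (1 - x) * (s ^ k * exp (- (1/3) * s ^ 3 + 0 * s ^ 2 + 0 * s)))"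
  proof (rule integral_cong)
    fix s :: real assume "s \<in> {0<..}"
    then have s: "s > 0" by simp
    \<comment> \<open>Since \<open>3 * (x - 1) = k - 2\<close>, the Jacobian \<open>s ^ 2\<close>
      leaves exactly \<open>s ^ k\<close>.\<close>
    have "(s ^ 3 / 3) powr (x - 1) = (s powr 3) powr (x - 1) * 3 powr (1 - x)"
      using s powr_minus_divide[of 3 "x - 1"] by (simp add: powr_divide)
    also have "(s powr 3) powr (x - 1) = s powr (real k - 2)"
      unfolding powr_powr by (rule arg_cong[where f = "\<lambda>y. s powr y"]) (simp add: x_def field_simps)
    also have "\<bar>s ^ 2\<bar> = s powr 2" using s by simp
    then have "\<bar>s ^ 2\<bar> * (s powr (real k - 2) * 3 powr (1 - x)) = s ^ k * 3 powr (1 - x)"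
      using s by (simp add: powr_add[symmetric] powr_realpow[symmetric] del: powr_numeral)
    finally show "\<bar>s ^ 2\<bar> * f (s ^ 3 / 3) = 3 powr (1 - x) * (s ^ k * exp (- (1/3) * s ^ 3 + 0 * s ^ 2 + 0 * s))"
      by (simp add: f_def exp_minus field_simps)
  qed
  also have "\<dots> = 3 powr (1 - x) * (LINT s:{0<..}|lborel. s ^ k * exp (- (1/3) * s ^ 3 + 0 * s ^ 2 + 0 * s))"
    by (subst set_borel_integral_eq_integral(2)[OF power_times_cubic_exp_integrable]) auto
  finally have real: "(LINT s:{0<..}|lborel. s ^ k * exp (- (1/3) * s ^ 3 + 0 * s ^ 2 + 0 * s))
      = Gamma x / 3 powr (1 - x)"
    by (simp add: field_simps)
  have "cubic_moment k (1/3) 0 0 =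
      (LINT s:{0<..}|lborel. of_real (s ^ k * exp (- (1/3) * s ^ 3 + 0 * s ^ 2 + 0 * s)))"
    unfolding cubic_moment_def cubic_exp_def by (simp flip: exp_of_real)
  also have "\<dots> = of_real (Gamma x / 3 powr (1 - x))"
    unfolding set_integral_complex_of_real real ..
  finally show ?thesis by (simp add: x_def add_ac)
qed

section \<open>Integral representations\<close>

text \<open>The integral of \<open>exp (z t - t\<^sup>3/3)\<close> along the half-line \<open>{d s | s > 0}\<close>.\<close>

definition airy_ray :: "complex \<Rightarrow> complex \<Rightarrow> complex" where
  "airy_ray d z = d * cubic_moment 0 (d ^ 3 / 3) 0 (z * d)"

lemma cubic_moment_DERIV_linear:
  assumes "Re (d ^ 3) > 0"
  shows "((\<lambda>z. cubic_moment k (d ^ 3 / 3) 0 (z * d)) has_field_derivative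
    d * cubic_moment (k + 1) (d ^ 3 / 3) 0 (z * d)) (at z)"
proof -
  let ?M = "\<lambda>k. cubic_moment k (d ^ 3 / 3) 0 (z * d)"
  have "((\<lambda>z. cubic_moment k (d ^ 3 / 3) 0 (z * d)) has_field_derivative
      (- 0 * ?M (k + 3) + 0 * ?M (k + 2) + d * ?M (k + 1))) (at z)"
    by (rule cubic_moment_DERIV[of UNIV]) (use assms in \<open>auto intro!: derivative_eq_intros\<close>)
  then show ?thesis by simp
qed

text \<open>Integration by parts trades a factor \<open>z\<close> for a moment two orders higher
  plus a lower-order term. In the third identity this turns the second derivative into
  \<open>z f + 1\<close>; the last two also give the limits of \<open>z f\<close> and
  \<open>z^2 f'\<close> along a ray.\<close>

lemma airy_ray_DERIV:
  assumes "Re (d ^ 3) > 0"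
  defines "G \<equiv> \<lambda>z. d ^ 2 * cubic_moment 1 (d ^ 3 / 3) 0 (z * d)"
  shows "(airy_ray d has_field_derivative G z) (at z)"
    and "(G has_field_derivative z * airy_ray d z + 1) (at z)"
    and "z * airy_ray d z = d ^ 3 * cubic_moment 2 (d ^ 3 / 3) 0 (z * d) - 1"
    and "z * G z = d ^ 4 * cubic_moment 3 (d ^ 3 / 3) 0 (z * d) - airy_ray d z"
proof -
  have pos: "Re (d ^ 3 / 3) > 0" using assms by simp
  show *: "z * airy_ray d z = d ^ 3 * cubic_moment 2 (d ^ 3 / 3) 0 (z * d) - 1"
    using cubic_moment_FTC(1)[OF pos, of 0 "z * d"] by (simp add: airy_ray_def algebra_simps add_eq_0_iff)
  have "d * (cubic_moment 0 (d ^ 3 / 3) 0 (z * d) - 3 * (d ^ 3 / 3) * cubic_moment 3 (d ^ 3 / 3) 0 (z * d)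
      + z * d * cubic_moment 1 (d ^ 3 / 3) 0 (z * d)) = 0"
    using cubic_moment_FTC(2)[OF pos, of 0 "z * d"] by simp
  then show "z * G z = d ^ 4 * cubic_moment 3 (d ^ 3 / 3) 0 (z * d) - airy_ray d z"
    by (simp add: airy_ray_def G_def algebra_simps power2_eq_square power3_eq_cube power4_eq_xxxx)
  show "(airy_ray d has_field_derivative G z) (at z)"
    unfolding airy_ray_def[abs_def] G_def
    using DERIV_cmult[OF cubic_moment_DERIV_linear[OF assms(1), of 0 z], of d]
    by (simp add: power2_eq_square mult.assoc)
  show "(G has_field_derivative z * airy_ray d z + 1) (at z)"
    unfolding * unfolding G_def
    using DERIV_cmult[OF cubic_moment_DERIV_linear[OF assms(1), of 1 z], of "d ^ 2"]
    by (simp add: power2_eq_square power3_eq_cube mult.assoc numeral_2_eq_2)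
qed

text \<open>The sector |arg d| < pi/6, written with linear inequalities so that it is an
  intersection of two open half-planes.\<close>

definition airy_sector :: "complex set" where
  "airy_sector = {d. sqrt 3 * Im d < Re d \<and> - sqrt 3 * Im d < Re d}"

lemma airy_sector_cube_pos:
  assumes "d \<in> airy_sector"
  shows "Re (d ^ 3) > 0"
proof -
  have *: "sqrt 3 * Im d < Re d" "- sqrt 3 * Im d < Re d" using assms by (auto simp: airy_sector_def)
  then have "Re d > 0" by linarith
  moreover have "(Re d - sqrt 3 * Im d) * (Re d + sqrt 3 * Im d) > 0"
    using * by (intro mult_pos_pos) linarith+
  then have "(Re d)\<^sup>2 - (sqrt 3 * Im d)\<^sup>2 > 0"
    by (simp add: algebra_simps power2_eq_square)
  then have "(Re d)\<^sup>2 - 3 * (Im d)\<^sup>2 > 0"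
    by (simp add: power_mult_distrib)
  moreover have "Re (d ^ 3) = Re d * ((Re d)\<^sup>2 - 3 * (Im d)\<^sup>2)"
    by (simp add: power3_eq_cube power2_eq_square algebra_simps)
  ultimately show ?thesis by simp
qed

lemma convex_airy_sector: "convex airy_sector"
  and open_airy_sector: "open airy_sector"
proof -
  have *: "airy_sector = {d. Complex (- 1) (sqrt 3) \<bullet> d < 0} \<inter> {d. Complex (- 1) (- sqrt 3) \<bullet> d < 0}"
    by (auto simp: airy_sector_def inner_complex_def)
  show "convex airy_sector" unfolding * by (intro convex_Int convex_halfspace_lt)
  show "open airy_sector" unfolding * by (intro open_Int open_halfspace_lt)
qed

text \<open>The derivative of the integrand in \<open>d\<close> is the derivative of \<open>s exp (z d s - d\<^sup>3 s\<^sup>3/3)\<close> in \<open>s\<close>.\<close>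

lemma airy_ray_rotate:
  assumes "d \<in> airy_sector"
  shows "airy_ray d z = airy_ray 1 z"
proof -
  have "((\<lambda>d. airy_ray d z) has_field_derivative 0) (at d within airy_sector)" if d: "d \<in> airy_sector" for d
  proof -
    have pos: "Re (d ^ 3 / 3) > 0" using airy_sector_cube_pos[OF d] by simp
    let ?M = "\<lambda>k. cubic_moment k (d ^ 3 / 3) 0 (z * d)"
    have "((\<lambda>d. cubic_moment 0 (d ^ 3 / 3) 0 (z * d)) has_field_derivative
        (- (d ^ 2) * ?M (0 + 3) + 0 * ?M (0 + 2) + z * ?M (0 + 1))) (at d)"
      by (rule cubic_moment_DERIV[OF open_airy_sector d])
        (auto intro!: derivative_eq_intros continuous_intros airy_sector_cube_pos)
    then have "((\<lambda>d. airy_ray d z) has_field_derivative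
        ?M 0 + d * (- (d ^ 2) * ?M 3 + z * ?M 1)) (at d)"
      unfolding airy_ray_def by (auto intro!: derivative_eq_intros)
    moreover have "?M 0 + d * (- (d ^ 2) * ?M 3 + z * ?M 1) = 0"
      using cubic_moment_FTC(2)[OF pos, of 0 "z * d"]
      by (simp add: algebra_simps power2_eq_square power3_eq_cube)
    ultimately show ?thesis by (simp add: has_field_derivative_at_within)
  qed
  then have "\<exists>k. \<forall>d\<in>airy_sector. airy_ray d z = k"
    by (intro has_field_derivative_zero_constant[OF convex_airy_sector])
  moreover have "1 \<in> airy_sector" by (simp add: airy_sector_def)
  ultimately show ?thesis using assms by metis
qed

text \<open>A cube root of unity leaves \<open>d ^ 3\<close> unchanged. Directions near
  \<open>omega\<close> and \<open>cnj omega\<close> are thus brought back to the sector around 1,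
  where they can be rotated.\<close>

lemma airy_ray_root_of_unity: "\<omega> ^ 3 = 1 \<Longrightarrow> airy_ray (\<omega> * d) z = \<omega> * airy_ray d (\<omega> * z)"
  by (simp add: airy_ray_def power_mult_distrib mult_ac)

section \<open>The integrals for Ai and Gi\<close>

definition omega :: complex where "omega = Complex (- 1 / 2) (sqrt 3 / 2)"

lemma omega:
  "omega ^ 3 = 1" "cnj omega ^ 3 = 1" "omega ^ 2 = cnj omega" "cnj omega ^ 2 = omega"
  "omega + cnj omega = - 1" "omega - cnj omega = \<i> * of_real (sqrt 3)"
proof -
  show sq: "omega ^ 2 = cnj omega"
    by (simp add: omega_def complex_eq_iff power2_eq_square)
  have "omega ^ 3 = omega ^ 2 * omega" by (simp add: power3_eq_cube power2_eq_square)
  also have "\<dots> = 1" unfolding sq by (simp add: omega_def complex_eq_iff)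
  finally show cube: "omega ^ 3 = 1" .
  show "cnj omega ^ 3 = 1" "cnj omega ^ 2 = omega"
    by (simp_all flip: complex_cnj_power add: cube sq)
  show "omega + cnj omega = - 1" "omega - cnj omega = \<i> * of_real (sqrt 3)"
    by (simp_all add: omega_def complex_eq_iff)
qed

definition airy_M0 :: real where "airy_M0 = Gamma (1/3) / 3 powr (2/3)"
definition airy_M1 :: real where "airy_M1 = Gamma (2/3) / 3 powr (1/3)"

lemma airy_ray_at_0:
  assumes "\<omega> ^ 3 = 1"
  shows "airy_ray \<omega> 0 = \<omega> * of_real airy_M0"
    and "cubic_moment 1 (\<omega> ^ 3 / 3) 0 (0 * \<omega>) = of_real airy_M1"
  using assms cubic_moment_Gamma[of 0] cubic_moment_Gamma[of 1]
  by (simp_all add: airy_ray_def airy_M0_def airy_M1_def)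

lemma Gamma_third: "Gamma (1/3) * Gamma (2/3 :: real) = 2 * pi / sqrt 3"
proof -
  have "complex_of_real (Gamma (1/3) * Gamma (2/3)) = Gamma (1/3) * Gamma (1 - 1/3)"
    by (simp flip: Gamma_complex_of_real)
  also have "\<dots> = of_real pi / sin (of_real pi * (1/3))" by (rule Gamma_reflection_complex)
  also have "sin (of_real pi * (1/3)) = complex_of_real (sin (pi / 3))"
    by (simp flip: sin_of_real)
  also have "of_real pi / complex_of_real (sin (pi / 3)) = of_real (2 * pi / sqrt 3)"
    by (simp add: sin_60 field_simps)
  finally show ?thesis by (simp only: of_real_eq_iff)
qed

text \<open>The integrals produce Gamma in the numerator, the standard normalisations have the
  complementary value in the denominator; \<open>Gamma_third\<close> links the two. The factors
  \<open>sqrt 3 / (2 * pi)\<close> and \<open>1 / (2 * pi)\<close> come from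
  \<open>omega - cnj omega\<close> and \<open>omega + cnj omega\<close>.\<close>

lemma airy_moment_values:
  "airy_M0 * sqrt 3 / (2 * pi) = 1 / (3 powr (2/3) * Gamma (2/3))"
  "airy_M1 * sqrt 3 / (2 * pi) = 1 / (3 powr (1/3) * Gamma (1/3))"
  "airy_M0 / (2 * pi) = 1 / (3 powr (1/6) * Gamma (2/3)) / 3"
  "airy_M1 / (2 * pi) = 3 powr (1/6) / Gamma (1/3) / 3"
proof -
  define g h where "g = Gamma (1/3 :: real)" and "h = Gamma (2/3 :: real)"
  have pos: "g > 0" "h > 0" by (auto simp: g_def h_def intro!: Gamma_real_pos)
  have gh: "g * h = 2 * pi / sqrt 3" using Gamma_third by (simp add: g_def h_def)
  have pi: "2 * pi = g * h * sqrt 3" unfolding gh by simp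
  have s: "sqrt 3 = 3 powr (1/2)" by (simp add: powr_half_sqrt)
  have M: "airy_M0 = g / 3 powr (2/3)" "airy_M1 = h / 3 powr (1/3)"
    by (simp_all add: airy_M0_def airy_M1_def g_def h_def)
  show "airy_M0 * sqrt 3 / (2 * pi) = 1 / (3 powr (2/3) * Gamma (2/3))"
    "airy_M1 * sqrt 3 / (2 * pi) = 1 / (3 powr (1/3) * Gamma (1/3))"
    unfolding pi M g_def[symmetric] h_def[symmetric] using pos by (simp_all add: field_simps)
  have e1: "3 powr (2/3) * (3 powr (1/2)) = (3 powr (1/6) * 3 :: real)"
    using powr_add[of 3 "1/6" "1 :: real"] by (simp add: powr_add[symmetric])
  have e2: "3 powr (1/3) * (3 powr (1/2)) * (3 powr (1/6)) = (3 :: real)"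
    by (simp add: powr_add[symmetric])
  have "airy_M0 / (2 * pi) = 1 / (h * (3 powr (2/3) * 3 powr (1/2)))"
    unfolding pi M s using pos by (simp add: field_simps)
  also have "\<dots> = 1 / (3 powr (1/6) * h) / 3" unfolding e1 by (simp add: mult_ac)
  finally show "airy_M0 / (2 * pi) = 1 / (3 powr (1/6) * Gamma (2/3)) / 3" by (simp add: h_def)
  have "airy_M1 / (2 * pi) = 1 / (g * (3 powr (1/3) * 3 powr (1/2)))"
    unfolding pi M s using pos by (simp add: field_simps)
  also have "\<dots> = 3 powr (1/6) / (g * (3 powr (1/3) * (3 powr (1/2)) * (3 powr (1/6))))"
    by simp
  also have "\<dots> = 3 powr (1/6) / g / 3" unfolding e2 by simp
  finally show "airy_M1 / (2 * pi) = 3 powr (1/6) / Gamma (1/3) / 3" by (simp add: g_def)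
qed

lemma omega_pos: "Re (omega ^ 3) > 0" "Re (cnj omega ^ 3) > 0"
  by (simp_all add: omega)

text \<open>The contour runs in from infinity along \<open>cnj omega\<close> and out along
  \<open>omega\<close>. In the difference the two inhomogeneities 1 cancel.\<close>

lemma Ai_integral: "Ai z = (airy_ray omega z - airy_ray (cnj omega) z) / (2 * of_real pi * \<i>)"
proof -
  let ?k = "2 * of_real pi * \<i>"
  let ?G = "\<lambda>d z. d ^ 2 * cubic_moment 1 (d ^ 3 / 3) 0 (z * d)"
  define F G where "F z = (airy_ray omega z - airy_ray (cnj omega) z) / ?k"
    and "G z = (?G omega z - ?G (cnj omega) z) / ?k" for z
  have "F = airy_ivp 0 (F 0) (G 0)"
  proof (rule airy_ivp_unique)
    show "(F has_field_derivative G w) (at w)" for w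
      unfolding F_def G_def
      by (intro DERIV_cdivide DERIV_diff airy_ray_DERIV omega_pos)
    have "(G has_field_derivative ((w * airy_ray omega w + 1) - (w * airy_ray (cnj omega) w + 1)) / ?k) (at w)" for w
      unfolding G_def
      by (intro DERIV_cdivide DERIV_diff airy_ray_DERIV omega_pos)
    then show "(G has_field_derivative w * F w + 0) (at w)" for w
      by (simp add: F_def algebra_simps diff_divide_distrib)
  qed
  moreover have "F 0 = of_real (1 / (3 powr (2/3) * Gamma (2/3)))"
  proof -
    have "F 0 = (omega - cnj omega) * of_real airy_M0 / ?k"
      unfolding F_def airy_ray_at_0[OF omega(1)] airy_ray_at_0[OF omega(2)] by (simp add: algebra_simps)
    also have "\<dots> = of_real (airy_M0 * sqrt 3 / (2 * pi))" unfolding omega by simp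
    finally show ?thesis unfolding airy_moment_values .
  qed
  moreover have "G 0 = of_real (- 1 / (3 powr (1/3) * Gamma (1/3)))"
  proof -
    have "G 0 = - (omega - cnj omega) * of_real airy_M1 / ?k"
      unfolding G_def airy_ray_at_0[OF omega(1)] airy_ray_at_0[OF omega(2)] omega(3,4)
      by (simp add: algebra_simps)
    also have "\<dots> = of_real (- (airy_M1 * sqrt 3 / (2 * pi)))" unfolding omega by simp
    finally show ?thesis unfolding airy_moment_values by simp
  qed
  ultimately have "F = Ai" unfolding Ai_def by metis
  then have "Ai z = F z" by simp
  then show ?thesis by (simp only: F_def)
qed

text \<open>In the sum the inhomogeneities add up to 2, and division by \<open>- 2 * pi\<close>
  produces the \<open>- 1 / pi\<close> of the Scorer equation.\<close>

lemma Gi_integral: "Gi z = - (airy_ray omega z + airy_ray (cnj omega) z) / (2 * of_real pi)"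
proof -
  let ?k = "2 * of_real pi :: complex"
  let ?G = "\<lambda>d z. d ^ 2 * cubic_moment 1 (d ^ 3 / 3) 0 (z * d)"
  define F G where "F z = - (airy_ray omega z + airy_ray (cnj omega) z) / ?k"
    and "G z = - (?G omega z + ?G (cnj omega) z) / ?k" for z
  have F: "(F has_field_derivative G w) (at w)" for w
    unfolding F_def G_def
    by (intro DERIV_cdivide DERIV_minus DERIV_add airy_ray_DERIV omega_pos)
  have "F = airy_ivp (- 1 / of_real pi) (F 0) (G 0)"
  proof (rule airy_ivp_unique[OF F])
    have "(G has_field_derivative - ((w * airy_ray omega w + 1) + (w * airy_ray (cnj omega) w + 1)) / ?k) (at w)" for w
      unfolding G_def
      by (intro DERIV_cdivide DERIV_minus DERIV_add airy_ray_DERIV omega_pos)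
    moreover have "- ((w * airy_ray omega w + 1) + (w * airy_ray (cnj omega) w + 1)) / ?k
        = w * F w + - 1 / of_real pi" for w
      by (simp add: F_def field_simps)
    ultimately show "(G has_field_derivative w * F w + - 1 / of_real pi) (at w)" for w
      by simp
  qed
  moreover have "F 0 = of_real (1 / (3 powr (1/6) * Gamma (2/3)) / 3)"
  proof -
    have "F 0 = - (omega + cnj omega) * of_real airy_M0 / ?k"
      unfolding F_def airy_ray_at_0[OF omega(1)] airy_ray_at_0[OF omega(2)] by (simp add: algebra_simps)
    also have "\<dots> = of_real (airy_M0 / (2 * pi))" unfolding omega by simp
    finally show ?thesis unfolding airy_moment_values .
  qed
  moreover have "G 0 = of_real (3 powr (1/6) / Gamma (1/3) / 3)"
  proof -
    have "G 0 = - (omega + cnj omega) * of_real airy_M1 / ?k"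
      unfolding G_def airy_ray_at_0[OF omega(1)] airy_ray_at_0[OF omega(2)] omega(3,4) by (simp add: algebra_simps)
    also have "\<dots> = of_real (airy_M1 / (2 * pi))" unfolding omega by simp
    finally show ?thesis unfolding airy_moment_values .
  qed
  ultimately have "F = Gi" unfolding Gi_def by metis
  then have "Gi z = F z" by simp
  then show ?thesis by (simp only: F_def)
qed

section \<open>Asymptotics along a ray\<close>

lemma deriv_airy_ray:
  assumes "Re (d ^ 3) > 0"
  shows "deriv (airy_ray d) z = d ^ 2 * cubic_moment 1 (d ^ 3 / 3) 0 (z * d)"
    and "(airy_ray d has_field_derivative deriv (airy_ray d) z) (at z)"
  using airy_ray_DERIV(1)[OF assms, of z] DERIV_imp_deriv by (blast, metis DERIV_imp_deriv)

text \<open>\<open>Re (z * d)\<close> tends to minus infinity linearly in \<open>Y\<close>, so the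
  moment of order \<open>k\<close> is of size \<open>Y^(-k-1)\<close> at most. In the identities of
  \<open>airy_ray_DERIV\<close> only the boundary term then survives.\<close>

lemma airy_ray_tendsto:
  fixes c d z0 :: complex
  assumes d: "Re (d ^ 3) > 0" and cd: "Re (c * d) < 0"
  defines "z \<equiv> \<lambda>Y. c * of_real Y + z0"
  shows "((\<lambda>Y. z Y * airy_ray d (z Y)) \<longlongrightarrow> - 1) at_top"
    and "((\<lambda>Y. z Y ^ 2 * deriv (airy_ray d) (z Y)) \<longlongrightarrow> 1) at_top"
proof -
  let ?M = "\<lambda>k Y. cubic_moment k (d ^ 3 / 3) 0 (z Y * d)"
  define \<kappa> m where "\<kappa> = - Re (c * d)" and "m = Re (z0 * d)"
  have \<kappa>: "\<kappa> > 0" using cd by (simp add: \<kappa>_def)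
  have Re_zd: "Re (z Y * d) = - (\<kappa> * Y - m)" for Y
    by (simp add: z_def \<kappa>_def m_def algebra_simps)
  have large: "eventually (\<lambda>Y. \<kappa> * Y - m > 0) at_top"
    using \<kappa> by real_asymp
  have M: "eventually (\<lambda>Y. norm (?M k Y) \<le> fact k * 2 ^ (k + 1) / (\<kappa> * Y - m) ^ (k + 1)) at_top" for k
    using large
  proof eventually_elim
    case (elim Y)
    show ?case
      by (rule norm_cubic_moment_le) (use d elim in \<open>simp_all add: Re_zd del: times_complex.sel\<close>)
  qed
  have "((\<lambda>Y. fact 2 * 2 ^ (2 + 1) / (\<kappa> * Y - m) ^ (2 + 1)) \<longlongrightarrow> 0) at_top"
    using \<kappa> by real_asymp
  from Lim_null_comparison[OF M[of 2] this] have M2: "(?M 2 \<longlongrightarrow> 0) at_top" .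
  \<comment> \<open>Adding 1 makes both constants positive, which fixes their sign in the limit
    computation.\<close>
  define C D where "C = norm c + 1" and "D = norm z0 + 1"
  have CD: "C > 0" "D > 0" by (simp_all add: C_def D_def add_nonneg_pos)
  have M3: "((\<lambda>Y. z Y * ?M 3 Y) \<longlongrightarrow> 0) at_top"
  proof (rule Lim_null_comparison)
    show "((\<lambda>Y. (C * Y + D) * (fact 3 * 2 ^ (3 + 1) / (\<kappa> * Y - m) ^ (3 + 1))) \<longlongrightarrow> 0) at_top"
      using \<kappa> CD by real_asymp
    show "eventually (\<lambda>Y. norm (z Y * ?M 3 Y) \<le> (C * Y + D) * (fact 3 * 2 ^ (3 + 1) / (\<kappa> * Y - m) ^ (3 + 1))) at_top"
      using M[of 3] eventually_ge_at_top[of 0]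
    proof eventually_elim
      case (elim Y)
      have "norm (z Y) \<le> norm c * Y + norm z0"
        unfolding z_def using elim by (intro norm_triangle_le) (simp add: norm_mult)
      also have "\<dots> \<le> C * Y + D"
        using elim by (intro add_mono mult_right_mono) (simp_all add: C_def D_def)
      finally show ?case
        unfolding norm_mult using elim CD by (intro mult_mono) auto
    qed
  qed
  have "((\<lambda>Y. d ^ 3 * ?M 2 Y - 1) \<longlongrightarrow> d ^ 3 * 0 - 1) at_top" by (intro tendsto_intros M2)
  then show 1: "((\<lambda>Y. z Y * airy_ray d (z Y)) \<longlongrightarrow> - 1) at_top"
    by (simp add: airy_ray_DERIV(3)[OF d])
  have eq: "z Y ^ 2 * deriv (airy_ray d) (z Y) = d ^ 4 * (z Y * ?M 3 Y) - z Y * airy_ray d (z Y)" for Y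
    using arg_cong[OF airy_ray_DERIV(4)[OF d, of "z Y"], of "\<lambda>u. z Y * u"]
    by (simp add: deriv_airy_ray(1)[OF d] power2_eq_square[of "z Y"] algebra_simps)
  have "((\<lambda>Y. d ^ 4 * (z Y * ?M 3 Y) - z Y * airy_ray d (z Y)) \<longlongrightarrow> d ^ 4 * 0 - (- 1)) at_top"
    by (intro tendsto_intros M3 1)
  then show "((\<lambda>Y. z Y ^ 2 * deriv (airy_ray d) (z Y)) \<longlongrightarrow> 1) at_top"
    by (simp add: eq)
qed

text \<open>Each integral is invariant by itself, so the two half-lines may be turned by different
  amounts.\<close>

lemma Gi_rays:
  assumes "d1 \<in> airy_sector" "d2 \<in> airy_sector"
  shows "Gi z = - (airy_ray (omega * d1) z + airy_ray (cnj omega * d2) z) / (2 * of_real pi)"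
    and "deriv Gi z = - (deriv (airy_ray (omega * d1)) z + deriv (airy_ray (cnj omega * d2)) z) / (2 * of_real pi)"
proof -
  show *: "Gi z = - (airy_ray (omega * d1) z + airy_ray (cnj omega * d2) z) / (2 * of_real pi)" for z
    using airy_ray_root_of_unity[OF omega(1)] airy_ray_root_of_unity[OF omega(2)] airy_ray_rotate[OF assms(1)]
      airy_ray_rotate[OF assms(2)] airy_ray_root_of_unity[OF omega(1), of 1] airy_ray_root_of_unity[OF omega(2), of 1]
    by (simp add: Gi_integral)
  have "(Gi has_field_derivative - (deriv (airy_ray (omega * d1)) z + deriv (airy_ray (cnj omega * d2)) z)
      / (2 * of_real pi)) (at z)"
    unfolding *[abs_def] using airy_sector_cube_pos assms
    by (intro DERIV_cdivide DERIV_minus DERIV_add deriv_airy_ray) (simp_all add: power_mult_distrib omega)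
  then show "deriv Gi z = - (deriv (airy_ray (omega * d1)) z + deriv (airy_ray (cnj omega * d2)) z) / (2 * of_real pi)"
    by (rule DERIV_imp_deriv)
qed

text \<open>In polar form: doubling |arg \<gamma>| < pi/6 gives an argument below pi/3.\<close>

lemma airy_sector_square:
  assumes "\<gamma> \<in> airy_sector"
  shows "Re (\<gamma>\<^sup>2) > 0" "\<bar>Im (\<gamma>\<^sup>2)\<bar> < sqrt 3 * Re (\<gamma>\<^sup>2)"
proof -
  define x y r where "x = Re \<gamma>" and "y = Im \<gamma>" and "r = sqrt 3"
  have r: "r * r = 3" "r > 0" by (simp_all add: r_def)
  have *: "x - r * y > 0" "x + r * y > 0" using assms by (simp_all add: airy_sector_def x_def y_def r_def)
  then have "x > 0" by linarith
  have "r * (x + r * y) > 0" "r * (x - r * y) > 0" using * r by simp_all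
  then have "r * x + 3 * y > 0" "r * x - 3 * y > 0" using r by (simp_all add: algebra_simps flip: mult.assoc)
  then have **: "r * x + y > 0" "r * x - y > 0" using r \<open>x > 0\<close> mult_pos_pos[of r x] by linarith+
  have "(x - r * y) * (r * x + y) > 0" "(x + r * y) * (r * x - y) > 0" using * ** by simp_all
  moreover have "(x - r * y) * (r * x + y) = r * (x\<^sup>2 - y\<^sup>2) - (r * r - 1) * (x * y)"
    "(x + r * y) * (r * x - y) = r * (x\<^sup>2 - y\<^sup>2) + (r * r - 1) * (x * y)"
    by (simp_all add: algebra_simps power2_eq_square)
  ultimately have "\<bar>2 * (x * y)\<bar> < r * (x\<^sup>2 - y\<^sup>2)" unfolding r by simp
  then show "\<bar>Im (\<gamma>\<^sup>2)\<bar> < sqrt 3 * Re (\<gamma>\<^sup>2)"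
    by (simp add: x_def y_def r_def power2_eq_square algebra_simps)
  then have "0 < sqrt 3 * Re (\<gamma>\<^sup>2)" by linarith
  then show "Re (\<gamma>\<^sup>2) > 0" by (simp add: zero_less_mult_iff)
qed

lemma Gi_tendsto:
  fixes \<gamma> z0 :: complex
  assumes "\<gamma> \<in> airy_sector"
  defines "z \<equiv> \<lambda>Y. \<gamma>\<^sup>2 * of_real Y + z0"
  shows "((\<lambda>Y. z Y * Gi (z Y)) \<longlongrightarrow> 1 / of_real pi) at_top"
    and "((\<lambda>Y. z Y ^ 2 * deriv Gi (z Y)) \<longlongrightarrow> - 1 / of_real pi) at_top"
proof -
  define x y where "x = Re (\<gamma>\<^sup>2)" and "y = Im (\<gamma>\<^sup>2)"
  have xy: "x > 0" "\<bar>y\<bar> < sqrt 3 * x" using airy_sector_square[OF assms(1)] by (simp_all add: x_def y_def)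
  \<comment> \<open>The midpoint between \<open>\<bar>y\<bar> / x\<close> and \<open>sqrt 3\<close>.
    Staying below \<open>sqrt 3\<close> keeps the directions \<open>-\<delta> + i\<close> and
    \<open>-\<delta> - i\<close> in the rotated sectors; staying above
    \<open>\<bar>y\<bar> / x\<close> makes their products with \<open>\<gamma>\<^sup>2\<close> have
    negative real part.\<close>
  define \<delta> where "\<delta> = (sqrt 3 + \<bar>y\<bar> / x) / 2"
  have \<delta>: "\<delta> > 0" "\<delta> < sqrt 3" "\<bar>y\<bar> < \<delta> * x"
    using xy by (auto simp: \<delta>_def field_simps intro: add_pos_nonneg)
  \<comment> \<open>This is \<open>cnj omega * Complex (- \<delta>) 1\<close>, the wanted direction
    turned back to the sector around 1.\<close>
  define d where "d = Complex (\<delta> / 2 + sqrt 3 / 2) (sqrt 3 * \<delta> / 2 - 1 / 2)"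
  have d: "d \<in> airy_sector" "cnj d \<in> airy_sector"
    using \<delta> by (auto simp: d_def airy_sector_def algebra_simps)
  have od: "omega * d = Complex (- \<delta>) 1" "cnj omega * cnj d = Complex (- \<delta>) (- 1)"
    by (auto simp: omega_def d_def complex_eq_iff field_simps)
  have pos: "Re ((omega * d) ^ 3) > 0" "Re ((cnj omega * cnj d) ^ 3) > 0"
    using airy_sector_cube_pos[OF d(1)] airy_sector_cube_pos[OF d(2)] by (simp_all add: power_mult_distrib omega)
  have neg: "Re (\<gamma>\<^sup>2 * (omega * d)) < 0" "Re (\<gamma>\<^sup>2 * (cnj omega * cnj d)) < 0"
    unfolding od using \<delta> by (auto simp: x_def[symmetric] y_def[symmetric] algebra_simps abs_less_iff)
  have "((\<lambda>Y. - (z Y * airy_ray (omega * d) (z Y) + z Y * airy_ray (cnj omega * cnj d) (z Y)) / (2 * of_real pi))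
      \<longlongrightarrow> - (- 1 + - 1) / (2 * of_real pi)) at_top"
    unfolding z_def by (intro tendsto_intros airy_ray_tendsto pos neg) simp
  then show "((\<lambda>Y. z Y * Gi (z Y)) \<longlongrightarrow> 1 / of_real pi) at_top"
    by (simp add: Gi_rays[OF d] algebra_simps)
  have "((\<lambda>Y. - (z Y ^ 2 * deriv (airy_ray (omega * d)) (z Y) + z Y ^ 2 * deriv (airy_ray (cnj omega * cnj d)) (z Y))
      / (2 * of_real pi)) \<longlongrightarrow> - (1 + 1) / (2 * of_real pi)) at_top"
    unfolding z_def by (intro tendsto_intros airy_ray_tendsto pos neg) simp
  then show "((\<lambda>Y. z Y ^ 2 * deriv Gi (z Y)) \<longlongrightarrow> - 1 / of_real pi) at_top"
    by (simp add: Gi_rays[OF d] algebra_simps)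
qed

lemma tendsto_imp_bigtheta_ray:
  fixes f :: "complex \<Rightarrow> complex" and c z0 :: complex
  assumes "c \<noteq> 0" "L \<noteq> 0"
  defines "z \<equiv> \<lambda>Y :: real. c * of_real Y + z0"
  assumes lim: "((\<lambda>Y. z Y ^ k * f (z Y)) \<longlongrightarrow> L) at_top"
  shows "(\<lambda>Y. norm (f (z Y))) \<in> \<Theta>(\<lambda>Y. 1 / Y ^ k)"
proof (rule bigthetaI_tendsto)
  \<comment> \<open>This function is \<open>z Y / Y\<close>; it converts powers of \<open>z\<close>
    into powers of \<open>Y\<close>.\<close>
  have "((\<lambda>Y. c + z0 * of_real (1 / Y)) \<longlongrightarrow> c + z0 * of_real 0) at_top"
    by (intro tendsto_intros) real_asymp
  then have "((\<lambda>Y. norm (z Y ^ k * f (z Y)) / norm ((c + z0 * of_real (1 / Y)) ^ k)) \<longlongrightarrow> norm L / norm (c ^ k)) at_top"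
    using assms by (intro tendsto_intros lim) auto
  moreover have "eventually (\<lambda>Y. norm (z Y ^ k * f (z Y)) / norm ((c + z0 * of_real (1 / Y)) ^ k) =
      norm (f (z Y)) / (1 / Y ^ k)) at_top"
  proof -
    have "((\<lambda>Y. c + z0 * of_real (1 / Y)) \<longlongrightarrow> c + z0 * of_real 0) at_top"
      by (intro tendsto_intros) real_asymp
    then have "eventually (\<lambda>Y. c + z0 * of_real (1 / Y) \<noteq> 0) at_top"
      using assms(1) by (intro tendsto_imp_eventually_ne) auto
    then show ?thesis using eventually_gt_at_top[of 0]
    proof eventually_elim
      case (elim Y)
      have "z Y = (c + z0 * of_real (1 / Y)) * of_real Y" using elim by (simp add: z_def field_simps)
      then have "norm (z Y ^ k) = norm ((c + z0 * of_real (1 / Y)) ^ k) * Y ^ k"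
        using elim by (simp add: norm_mult power_mult_distrib norm_power)
      then show ?case using elim by (simp add: norm_mult)
    qed
  qed
  ultimately show "((\<lambda>Y. norm (f (z Y)) / (1 / Y ^ k)) \<longlongrightarrow> norm L / norm (c ^ k)) at_top"
    by (blast intro: Lim_transform_eventually)
  show "norm L / norm (c ^ k) \<noteq> 0" using assms by simp
qed

text \<open>The integral of \<open>exp (z t - t\<^sup>3/3)\<close> along the half-line from \<open>q\<close> in the direction \<open>\<omega>\<close>,
  a cube root of unity. Moving the vertex \<open>q\<close> of the contour of \<open>Ai\<close> to a saddle point exhibits the decay.\<close>

definition airy_shifted_ray :: "complex \<Rightarrow> complex \<Rightarrow> complex \<Rightarrow> complex" where
  "airy_shifted_ray \<omega> q z = exp (- (q ^ 3) / 3 + z * q) *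
     (\<omega> * cubic_moment 0 (1/3) (- q * \<omega>\<^sup>2) ((z - q\<^sup>2) * \<omega>))"

text \<open>The coefficients of the moment are those of \<open>z t - t^3/3\<close> expanded at
  \<open>t = q + \<omega> s\<close>. The derivative in \<open>q\<close> reduces to the boundary term
  at the vertex, which is the same for every \<omega>; it cancels between two half-lines with a
  common vertex.\<close>

lemma airy_shifted_ray_DERIV_vertex:
  assumes "\<omega> ^ 3 = 1"
  shows "((\<lambda>q. airy_shifted_ray \<omega> q z) has_field_derivative - exp (- (q ^ 3) / 3 + z * q)) (at q)"
proof -
  let ?M = "\<lambda>k. cubic_moment k (1/3) (- q * \<omega>\<^sup>2) ((z - q\<^sup>2) * \<omega>)"
  let ?E = "exp (- (q ^ 3) / 3 + z * q)"
  have M: "((\<lambda>q. cubic_moment 0 (1/3) (- q * \<omega>\<^sup>2) ((z - q\<^sup>2) * \<omega>)) has_field_derivative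
        (- 0 * ?M (0 + 3) + (- \<omega>\<^sup>2) * ?M (0 + 2) + (- 2 * q * \<omega>) * ?M (0 + 1))) (at q)"
    by (rule cubic_moment_DERIV[of UNIV]) (auto intro!: derivative_eq_intros continuous_intros)
  have "((\<lambda>q. exp (- (q ^ 3) / 3 + z * q)) has_field_derivative ?E * (z - q\<^sup>2)) (at q)"
    by (auto intro!: derivative_eq_intros simp: algebra_simps)
  from DERIV_mult[OF this DERIV_cmult[OF M, of \<omega>]]
  have "((\<lambda>q. airy_shifted_ray \<omega> q z) has_field_derivative
     ?E * ((z - q\<^sup>2) * \<omega> * ?M 0 - \<omega> ^ 3 * ?M 2 - 2 * q * \<omega>\<^sup>2 * ?M 1)) (at q)"
    unfolding airy_shifted_ray_def
    by (rule DERIV_cong) (simp add: algebra_simps power2_eq_square[of \<omega>] power2_eq_square[of q]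
      power3_eq_cube numeral_2_eq_2)
  moreover have "(z - q\<^sup>2) * \<omega> * ?M 0 - \<omega> ^ 3 * ?M 2 - 2 * q * \<omega>\<^sup>2 * ?M 1 = - 1"
    using cubic_moment_FTC(1)[of "1/3" "- q * \<omega>\<^sup>2" "(z - q\<^sup>2) * \<omega>"] assms by (simp add: algebra_simps)
  ultimately show ?thesis by simp
qed

lemma airy_shifted_ray_DERIV:
  "(airy_shifted_ray \<omega> q has_field_derivative exp (- (q ^ 3) / 3 + z * q) *
     (q * \<omega> * cubic_moment 0 (1/3) (- q * \<omega>\<^sup>2) ((z - q\<^sup>2) * \<omega>)
       + \<omega>\<^sup>2 * cubic_moment 1 (1/3) (- q * \<omega>\<^sup>2) ((z - q\<^sup>2) * \<omega>))) (at z)"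
proof -
  let ?M = "\<lambda>k. cubic_moment k (1/3) (- q * \<omega>\<^sup>2) ((z - q\<^sup>2) * \<omega>)"
  let ?E = "exp (- (q ^ 3) / 3 + z * q)"
  have M: "((\<lambda>z. cubic_moment 0 (1/3) (- q * \<omega>\<^sup>2) ((z - q\<^sup>2) * \<omega>)) has_field_derivative
        (- 0 * ?M (0 + 3) + 0 * ?M (0 + 2) + \<omega> * ?M (0 + 1))) (at z)"
    by (rule cubic_moment_DERIV[of UNIV]) (auto intro!: derivative_eq_intros continuous_intros)
  have "((\<lambda>z. exp (- (q ^ 3) / 3 + z * q)) has_field_derivative ?E * q) (at z)"
    by (auto intro!: derivative_eq_intros)
  from DERIV_mult[OF this DERIV_cmult[OF M, of \<omega>]] show ?thesis
    unfolding airy_shifted_ray_def[abs_def]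
    by (rule DERIV_cong) (simp add: algebra_simps power2_eq_square)
qed

section \<open>Exponential decay of Ai\<close>

lemma Ai_shifted:
  "Ai z = (airy_shifted_ray omega q z - airy_shifted_ray (cnj omega) q z) / (2 * of_real pi * \<i>)"
proof -
  let ?D = "\<lambda>q. airy_shifted_ray omega q z - airy_shifted_ray (cnj omega) q z"
  have "(?D has_field_derivative 0) (at q)" for q
    using DERIV_diff[OF airy_shifted_ray_DERIV_vertex[OF omega(1), of z q]
        airy_shifted_ray_DERIV_vertex[OF omega(2), of z q]]
    by simp
  then have "\<exists>k. \<forall>q\<in>UNIV. ?D q = k"
    by (intro has_field_derivative_zero_constant) auto
  then have "?D q = ?D 0" by (metis UNIV_I)
  also have "?D 0 = airy_ray omega z - airy_ray (cnj omega) z"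
    by (simp add: airy_shifted_ray_def airy_ray_def omega mult_ac)
  finally show ?thesis by (simp add: Ai_integral)
qed

lemma deriv_Ai_shifted:
  "deriv Ai z = (deriv (airy_shifted_ray omega q) z - deriv (airy_shifted_ray (cnj omega) q) z) / (2 * of_real pi * \<i>)"
  unfolding Ai_shifted[of _ q, abs_def]
  by (intro DERIV_imp_deriv DERIV_cdivide DERIV_diff)
    (use airy_shifted_ray_DERIV DERIV_imp_deriv in metis)+

text \<open>\<open>- p\<close> is a saddle point of \<open>p^2 t - t^3/3\<close>. With the vertex
  there, the prefactor has exponent \<open>- 2/3 p^3 - z0 p\<close>, the linear coefficient is the
  bounded number \<open>z0 * \<omega>\<close>, and the quadratic one, \<open>p * \<omega>^2\<close>,
  has nonpositive real part; the moments are therefore bounded uniformly in \<open>p\<close>. The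
  offset \<open>z0\<close> is treated as a perturbation and costs
  \<open>exp (norm z0 * norm p)\<close>.\<close>

lemma Ai_saddle_bound:
  obtains C where "C > 0"
    "\<And>p. p \<in> airy_sector \<Longrightarrow> norm (Ai (p\<^sup>2 + z0)) \<le> C * (1 + norm p) * exp (- 2 / 3 * Re (p ^ 3) + norm z0 * norm p)"
    "\<And>p. p \<in> airy_sector \<Longrightarrow> norm (deriv Ai (p\<^sup>2 + z0)) \<le> C * (1 + norm p) * exp (- 2 / 3 * Re (p ^ 3) + norm z0 * norm p)"
proof -
  have third: "Re (1/3) > 0" by simp
  obtain C0 where C0: "C0 \<ge> 0"
    "\<And>b e. Re b \<le> 0 \<Longrightarrow> Re e \<le> norm z0 \<Longrightarrow> norm (cubic_moment 0 (1/3) b e) \<le> C0"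
    using cubic_moment_bounded[OF third] by blast
  obtain C1 where C1: "C1 \<ge> 0"
    "\<And>b e. Re b \<le> 0 \<Longrightarrow> Re e \<le> norm z0 \<Longrightarrow> norm (cubic_moment 1 (1/3) b e) \<le> C1"
    using cubic_moment_bounded[OF third] by blast
  define C where "C = C0 + C1 + 1"
  define B where "B p = C * (1 + norm p) * exp (- 2 / 3 * Re (p ^ 3) + norm z0 * norm p)" for p
  have bounds: "norm (airy_shifted_ray \<omega> (- p) (p\<^sup>2 + z0)) \<le> B p"
    "norm (deriv (airy_shifted_ray \<omega> (- p)) (p\<^sup>2 + z0)) \<le> B p"
    if \<omega>: "norm \<omega> = 1" and p: "Re (p * \<omega>\<^sup>2) \<le> 0" for \<omega> p
  proof -
    let ?M = "\<lambda>k. cubic_moment k (1/3) (p * \<omega>\<^sup>2) (z0 * \<omega>)"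
    have z0: "Re (z0 * \<omega>) \<le> norm z0" using complex_Re_le_cmod[of "z0 * \<omega>"] \<omega> by (simp add: norm_mult)
    have M: "norm (?M 0) \<le> C0" "norm (?M 1) \<le> C1"
      using C0(2)[OF p z0] C1(2)[OF p z0] .
    have "- ((- p) ^ 3) / 3 + (p\<^sup>2 + z0) * (- p) = - 2 / 3 * p ^ 3 - z0 * p"
      by (simp add: field_simps power2_eq_square power3_eq_cube)
    then have "norm (exp (- ((- p) ^ 3) / 3 + (p\<^sup>2 + z0) * (- p))) = exp (- 2 / 3 * Re (p ^ 3) + Re (- (z0 * p)))"
      by simp
    also have "\<dots> \<le> exp (- 2 / 3 * Re (p ^ 3) + norm z0 * norm p)"
      using complex_Re_le_cmod[of "- (z0 * p)"] by (simp add: norm_mult)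
    finally have E: "norm (exp (- ((- p) ^ 3) / 3 + (p\<^sup>2 + z0) * (- p))) \<le> exp (- 2 / 3 * Re (p ^ 3) + norm z0 * norm p)" .
    have "norm (\<omega> * ?M 0) \<le> C * 1"
      using M C1(1) by (simp add: norm_mult \<omega> C_def)
    also have "\<dots> \<le> C * (1 + norm p)"
      using C0(1) C1(1) by (intro mult_left_mono) (auto simp: C_def)
    finally have "norm (\<omega> * ?M 0) \<le> C * (1 + norm p)" .
    with E show "norm (airy_shifted_ray \<omega> (- p) (p\<^sup>2 + z0)) \<le> B p"
      unfolding airy_shifted_ray_def B_def norm_mult[of "exp _"] mult.commute[of "C * _"]
      by (intro mult_mono) simp_all
    have "norm (- p * \<omega> * ?M 0 + \<omega>\<^sup>2 * ?M 1) \<le> norm p * norm (?M 0) + norm (?M 1)"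
      by (intro norm_triangle_le) (simp add: norm_mult \<omega> norm_power)
    also have "\<dots> \<le> norm p * C + C"
      using M C0(1) C1(1) by (intro add_mono mult_left_mono) (auto simp: C_def)
    finally have "norm (- p * \<omega> * ?M 0 + \<omega>\<^sup>2 * ?M 1) \<le> C * (1 + norm p)"
      by (simp add: algebra_simps)
    with E show "norm (deriv (airy_shifted_ray \<omega> (- p)) (p\<^sup>2 + z0)) \<le> B p"
      unfolding DERIV_imp_deriv[OF airy_shifted_ray_DERIV] B_def norm_mult[of "exp _"] mult.commute[of "C * _"]
      by (intro mult_mono) simp_all
  qed
  have omega_norm: "norm omega = 1" "norm (cnj omega) = 1"
    by (simp_all add: omega_def cmod_def power2_eq_square)
  have diff: "norm ((u - v) / (2 * of_real pi * \<i>)) \<le> b" if "norm u \<le> b" "norm v \<le> b" for u v b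
  proof -
    have "norm ((u - v) / (2 * of_real pi * \<i>)) = norm (u - v) / (2 * pi)"
      by (simp add: norm_divide norm_mult)
    also have "\<dots> \<le> (b + b) / (2 * pi)"
      using that pi_gt_zero by (intro divide_right_mono norm_triangle_le_diff add_mono) auto
    also have "\<dots> = b / pi" by simp
    also have "b \<ge> 0" using that norm_ge_zero order_trans by blast
    then have "b / pi \<le> b / 1"
      using pi_ge_two by (intro divide_left_mono) auto
    finally show ?thesis by simp
  qed
  \<comment> \<open>Up to a factor 1/2 these are the two inequalities that define the
    sector.\<close>
  have sector: "Re (p * omega\<^sup>2) \<le> 0" "Re (p * (cnj omega)\<^sup>2) \<le> 0" if "p \<in> airy_sector" for p
    using that unfolding omega by (auto simp: airy_sector_def omega_def mult.commute)
  show thesis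
  proof
    show "C > 0" using C0(1) C1(1) by (simp add: C_def)
    show "norm (Ai (p\<^sup>2 + z0)) \<le> C * (1 + norm p) * exp (- 2 / 3 * Re (p ^ 3) + norm z0 * norm p)"
      "norm (deriv Ai (p\<^sup>2 + z0)) \<le> C * (1 + norm p) * exp (- 2 / 3 * Re (p ^ 3) + norm z0 * norm p)"
      if "p \<in> airy_sector" for p
      unfolding Ai_shifted[of _ "- p"] deriv_Ai_shifted[of _ "- p"] B_def[symmetric]
      by (intro diff bounds omega_norm sector that)+
  qed
qed

text \<open>The saddle is taken at \<open>p = \<gamma> * sqrt Y\<close>. It gives the rate
  \<open>2 * \<kappa>\<close>; the half given up absorbs the factor \<open>1 + norm p\<close> and
  the perturbation by \<open>z0\<close>, whose exponent is only of order
  \<open>sqrt Y\<close>.\<close>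

lemma Ai_decay:
  fixes \<gamma> z0 :: complex
  assumes "\<gamma> \<in> airy_sector"
  defines "z \<equiv> \<lambda>Y. \<gamma>\<^sup>2 * of_real Y + z0" and "\<kappa> \<equiv> Re (\<gamma> ^ 3) / 3"
  shows "(\<lambda>Y. norm (Ai (z Y))) \<in> O(\<lambda>Y. exp (- \<kappa> * Y powr (3/2)))"
    and "(\<lambda>Y. norm (deriv Ai (z Y))) \<in> O(\<lambda>Y. exp (- \<kappa> * Y powr (3/2)))"
proof -
  have \<kappa>: "\<kappa> > 0" using airy_sector_cube_pos[OF assms(1)] by (simp add: \<kappa>_def)
  obtain C where C: "C > 0"
    "\<And>p. p \<in> airy_sector \<Longrightarrow> norm (Ai (p\<^sup>2 + z0)) \<le> C * (1 + norm p) * exp (- 2 / 3 * Re (p ^ 3) + norm z0 * norm p)"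
    "\<And>p. p \<in> airy_sector \<Longrightarrow> norm (deriv Ai (p\<^sup>2 + z0)) \<le> C * (1 + norm p) * exp (- 2 / 3 * Re (p ^ 3) + norm z0 * norm p)"
    using Ai_saddle_bound by blast
  \<comment> \<open>The summand 1 keeps \<open>m\<close> positive when \<open>z0 = 0\<close>, so
    that its sign is known to the asymptotic computation.\<close>
  define g m where "g = norm \<gamma>" and "m = (norm z0 + 1) * g"
  have "\<gamma> \<noteq> 0" using assms(1) by (auto simp: airy_sector_def)
  then have g: "g > 0" "m > 0" by (auto simp: g_def m_def intro!: mult_pos_pos add_nonneg_pos)
  define B where "B Y = C * (1 + g * Y powr (1/2)) * exp (- 2 * \<kappa> * Y powr (3/2) + m * Y powr (1/2))" for Y :: real
  have B: "B \<in> O(\<lambda>Y. exp (- \<kappa> * Y powr (3/2)))"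
    unfolding B_def using \<kappa> g C(1) by real_asymp
  have bound: "norm (Ai (z Y)) \<le> B Y" "norm (deriv Ai (z Y)) \<le> B Y" if "Y > 0" for Y
  proof -
    define p where "p = \<gamma> * of_real (sqrt Y)"
    have p: "p \<in> airy_sector"
      using assms(1) that mult_strict_right_mono[of "sqrt 3 * Im \<gamma>" "Re \<gamma>" "sqrt Y"]
        mult_strict_right_mono[of "- sqrt 3 * Im \<gamma>" "Re \<gamma>" "sqrt Y"]
      by (simp add: airy_sector_def p_def)
    have z: "z Y = p\<^sup>2 + z0" using that by (simp add: z_def p_def power_mult_distrib flip: of_real_power)
    have "sqrt Y ^ 3 = (Y powr (1/2)) powr 3" using that by (simp add: powr_half_sqrt)
    also have "\<dots> = Y powr (3/2)" by (simp add: powr_powr)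
    finally have "Re (p ^ 3) = 3 * \<kappa> * Y powr (3/2)"
      by (simp add: p_def power_mult_distrib \<kappa>_def flip: of_real_power)
    moreover have "norm p = g * Y powr (1/2)" using that by (simp add: p_def norm_mult g_def powr_half_sqrt)
    moreover have "norm z0 * (g * Y powr (1/2)) \<le> m * Y powr (1/2)"
      using g by (simp add: m_def algebra_simps)
    ultimately have "C * (1 + norm p) * exp (- 2 / 3 * Re (p ^ 3) + norm z0 * norm p) \<le> B Y"
      using g C(1) by (auto simp: B_def intro!: mult_left_mono)
    with C(2,3)[OF p] show "norm (Ai (z Y)) \<le> B Y" "norm (deriv Ai (z Y)) \<le> B Y"
      unfolding z by auto
  qed
  have ev: "eventually (\<lambda>Y. norm (f (z Y)) \<le> norm (B Y)) at_top"
    if "\<And>Y. Y > 0 \<Longrightarrow> norm (f (z Y)) \<le> B Y" for f :: "complex \<Rightarrow> complex"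
    using eventually_gt_at_top[of 0] by eventually_elim (use that in force)
  show "(\<lambda>Y. norm (Ai (z Y))) \<in> O(\<lambda>Y. exp (- \<kappa> * Y powr (3/2)))"
    "(\<lambda>Y. norm (deriv Ai (z Y))) \<in> O(\<lambda>Y. exp (- \<kappa> * Y powr (3/2)))"
    by (rule landau_o.big.trans[OF landau_o.big_mono B]; use ev bound in simp)+
qed

text \<open>Off the cut the imaginary part of the principal logarithm is strictly between -pi and
  pi, and a sixth of it lies in the open interval from -pi/6 to pi/6.\<close>

lemma powr_sixth_airy_sector:
  assumes "w \<notin> \<real>\<^sub>\<le>\<^sub>0"
  shows "w powr (1/6) \<in> airy_sector" "(w powr (1/6))\<^sup>2 = w powr (1/3)" "(w powr (1/3)) ^ 3 = w"
proof -
  have w: "w \<noteq> 0" using assms by auto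
  show "(w powr (1/6))\<^sup>2 = w powr (1/3)" "(w powr (1/3)) ^ 3 = w"
    using w by (simp_all add: powr_def flip: exp_of_nat_mult)
  define r \<phi> where "r = exp (Re (Ln w) / 6)" and "\<phi> = Im (Ln w) / 6"
  have "\<bar>Im (Ln w)\<bar> < pi" using assms w mpi_less_Im_Ln[of w] Im_Ln_less_pi[of w] by (auto simp: abs_less_iff)
  then have \<phi>: "- pi / 6 < \<phi>" "\<phi> < pi / 6" by (auto simp: \<phi>_def abs_less_iff)
  have wp: "Re (w powr (1/6)) = r * cos \<phi>" "Im (w powr (1/6)) = r * sin \<phi>"
    using w by (simp_all add: powr_def Re_exp Im_exp r_def \<phi>_def)
  \<comment> \<open>By the addition formulas these are the sector inequalities for the unit vector
    with argument \<phi>.\<close>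
  have "cos (\<phi> - pi / 3) > 0" "cos (\<phi> + pi / 3) > 0"
    using \<phi> by (intro cos_gt_zero_pi; simp)+
  then have "cos \<phi> + sqrt 3 * sin \<phi> > 0" "cos \<phi> - sqrt 3 * sin \<phi> > 0"
    by (simp_all add: cos_add cos_diff cos_60 sin_60 mult.commute)
  moreover have "r > 0" by (simp add: r_def)
  ultimately have "r * (cos \<phi> + sqrt 3 * sin \<phi>) > 0" "r * (cos \<phi> - sqrt 3 * sin \<phi>) > 0" by simp_all
  then show "w powr (1/6) \<in> airy_sector"
    unfolding airy_sector_def wp by (simp add: wp algebra_simps)
qed

section \<open>The adjoint system along a ray\<close>

text \<open>A complex derivative within the ray is a derivative in the real parameter divided by
  \<open>c\<close>. Both directions of the equivalence serve: an equation is carried from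
  \<open>Y\<close> to \<open>z\<close> to be solved, and its solution is carried back.\<close>

lemma affine_ray:
  fixes c z0 :: complex
  assumes "c \<noteq> 0"
  defines "z \<equiv> \<lambda>Y. c * of_real Y + z0"
  defines "ray \<equiv> z ` {0<..}"
  shows affine_ray_param: "Re ((z Y - z0) / c) = Y"
    and convex_affine_ray: "convex ray"
    and affine_ray_has_field_derivative: "Y > 0 \<Longrightarrow> (F has_field_derivative D) (at (z Y) within ray) \<longleftrightarrow>
      ((\<lambda>Y. F (z Y)) has_vector_derivative c * D) (at Y)"
    and affine_ray_limit_point: "w \<in> ray \<Longrightarrow> at w within ray \<noteq> bot"
proof -
  show "Re ((z Y - z0) / c) = Y" for Y using assms by (simp add: z_def)
  have "ray = (+) z0 ` ((\<lambda>Y. Y *\<^sub>R c) ` {0<..})"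
    by (auto simp: ray_def z_def image_iff scaleR_conv_of_real algebra_simps)
  then show "convex ray" by (auto intro!: convex_translation convex_scaled)
  have dist: "z y - z x = c * of_real (y - x)" for x y by (simp add: z_def algebra_simps)
  show iff: "(F has_field_derivative D) (at (z Y) within ray) \<longleftrightarrow>
      ((\<lambda>Y. F (z Y)) has_vector_derivative c * D) (at Y)" if Y: "Y > 0" for F D Y
  proof
    assume F: "(F has_field_derivative D) (at (z Y) within ray)"
    have "(z has_vector_derivative c) (at Y within {0<..})"
      unfolding z_def by (auto intro!: derivative_eq_intros)
    from field_vector_diff_chain_within[OF this F[unfolded ray_def]]
    have "(F \<circ> z has_vector_derivative c * D) (at Y within {0<..})" .
    moreover have "at Y within {0<..} = at Y" using Y by (intro at_within_open) auto
    ultimately show "((\<lambda>Y. F (z Y)) has_vector_derivative c * D) (at Y)" by (simp only: comp_def)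
  next
    assume f: "((\<lambda>Y. F (z Y)) has_vector_derivative c * D) (at Y)"
    show "(F has_field_derivative D) (at (z Y) within ray)"
      unfolding has_field_derivative_def has_derivative_within_alt
    proof (intro conjI allI impI)
      fix e :: real assume e: "e > 0"
      then have "e * norm c > 0" using assms by simp
      then obtain d where d: "d > 0" "\<And>y. norm (y - Y) < d \<Longrightarrow>
          norm (F (z y) - F (z Y) - (y - Y) *\<^sub>R (c * D)) \<le> (e * norm c) * norm (y - Y)"
        using f unfolding has_vector_derivative_def has_derivative_at_alt by blast
      show "\<exists>d>0. \<forall>y\<in>ray. norm (y - z Y) < d \<longrightarrow> norm (F y - F (z Y) - D * (y - z Y)) \<le> e * norm (y - z Y)"
      proof (intro exI[of _ "d * norm c"] conjI ballI impI)
        show "d * norm c > 0" using d assms by simp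
        fix w assume w: "w \<in> ray" "norm (w - z Y) < d * norm c"
        then obtain y where y: "w = z y" by (auto simp: ray_def)
        have "norm (y - Y) < d"
          using w(2) assms(1) unfolding y dist norm_mult norm_of_real by (simp add: mult.commute)
        from d(2)[OF this] show "norm (F w - F (z Y) - D * (w - z Y)) \<le> e * norm (w - z Y)"
          unfolding y dist norm_mult norm_of_real by (simp add: scaleR_conv_of_real mult_ac)
      qed
    qed (rule bounded_linear_mult_right)
  qed
  show "at w within ray \<noteq> bot" if w: "w \<in> ray"
  proof
    assume bot: "at w within ray = bot"
    obtain Y where Y: "Y > 0" "w = z Y" using w by (auto simp: ray_def)
    \<comment> \<open>At an isolated point any number would be a derivative, so the zero function
      would have derivative 1, against uniqueness in \<open>Y\<close>.\<close>
    have "((\<lambda>_. 0 :: complex) has_field_derivative 1) (at (z Y) within ray)"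
      using bot Y by (simp add: has_field_derivative_iff)
    then have "((\<lambda>_. 0 :: complex) has_vector_derivative c) (at Y)"
      using iff[OF Y(1), of "\<lambda>_. 0" 1] by simp
    then show False
      using vector_derivative_unique_at[OF _ has_vector_derivative_const] assms by blast
  qed
qed

section \<open>Separated modes and integrals along the ray\<close>

lemma plane_wave_DERIV:
  "((\<lambda>x. a * plane_wave \<alpha> x) has_vector_derivative - \<i> * \<alpha> * (a * plane_wave \<alpha> X)) (at X)"
proof -
  have "((\<lambda>x. a * exp (- \<i> * \<alpha> * x)) has_field_derivative - \<i> * \<alpha> * (a * plane_wave \<alpha> X)) (at (of_real X))"
    unfolding plane_wave_def by (auto intro!: derivative_eq_intros)
  from has_vector_derivative_real_field[OF this] show ?thesis
    by (simp add: plane_wave_def comp_def)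
qed

text \<open>At \<open>X = 0\<close> the plane wave is 1 and the system already yields the equations
  in \<open>Y\<close>; uniqueness of derivatives identifies the derivative in \<open>X\<close> with
  multiplication by \<open>- \<i> * \<alpha>\<close>. Conversely, the equations in \<open>Y\<close>
  are multiplied by the wave.\<close>

lemma adjoint_mode_iff:
  "adjoint_mode l W \<alpha> g q \<longleftrightarrow>
    (\<exists>g1 g2. \<forall>Y>0. (g has_vector_derivative g1 Y) (at Y) \<and> (g1 has_vector_derivative g2 Y) (at Y) \<and>
       (q has_vector_derivative of_real l * g Y) (at Y) \<and>
       - \<i> * of_real W * g Y + \<i> * \<alpha> * of_real (l * Y) * g Y - g2 Y + \<i> * \<alpha> * q Y = 0)"
proof
  assume "adjoint_mode l W \<alpha> g q"
  then obtain uX uY uYY qX qY where "\<forall>X. \<forall>Y>0.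
      ((\<lambda>x. g Y * plane_wave \<alpha> x) has_vector_derivative uX X Y) (at X) \<and>
      ((\<lambda>y. g y * plane_wave \<alpha> X) has_vector_derivative uY X Y) (at Y) \<and>
      ((\<lambda>y. uY X y) has_vector_derivative uYY X Y) (at Y) \<and>
      ((\<lambda>x. q Y * plane_wave \<alpha> x) has_vector_derivative qX X Y) (at X) \<and>
      ((\<lambda>y. q y * plane_wave \<alpha> X) has_vector_derivative qY X Y) (at Y) \<and>
      - \<i> * of_real W * (g Y * plane_wave \<alpha> X) - of_real (l * Y) * uX X Y - uYY X Y - qX X Y = 0 \<and>
      qY X Y = of_real l * (g Y * plane_wave \<alpha> X)"
    unfolding adjoint_mode_def adjoint_system_def by (elim exE)
  note sys = this[rule_format, THEN conjunct1] this[rule_format, THEN conjunct2, THEN conjunct1]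
    this[rule_format, THEN conjunct2, THEN conjunct2, THEN conjunct1]
    this[rule_format, THEN conjunct2, THEN conjunct2, THEN conjunct2, THEN conjunct1]
    this[rule_format, THEN conjunct2, THEN conjunct2, THEN conjunct2, THEN conjunct2, THEN conjunct1]
    this[rule_format, THEN conjunct2, THEN conjunct2, THEN conjunct2, THEN conjunct2, THEN conjunct2, THEN conjunct1]
    this[rule_format, THEN conjunct2, THEN conjunct2, THEN conjunct2, THEN conjunct2, THEN conjunct2, THEN conjunct2]
  have 1: "plane_wave \<alpha> 0 = 1" by (simp add: plane_wave_def)
  show "\<exists>g1 g2. \<forall>Y>0. (g has_vector_derivative g1 Y) (at Y) \<and> (g1 has_vector_derivative g2 Y) (at Y) \<and>
       (q has_vector_derivative of_real l * g Y) (at Y) \<and>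
       - \<i> * of_real W * g Y + \<i> * \<alpha> * of_real (l * Y) * g Y - g2 Y + \<i> * \<alpha> * q Y = 0"
  proof (intro exI allI impI conjI)
    fix Y :: real assume Y: "Y > 0"
    show "(g has_vector_derivative uY 0 Y) (at Y)" using sys(2)[OF Y, of 0] by (simp add: 1)
    show "(uY 0 has_vector_derivative uYY 0 Y) (at Y)" using sys(3)[OF Y, of 0] by simp
    show "(q has_vector_derivative of_real l * g Y) (at Y)"
      using sys(5)[OF Y, of 0] sys(7)[OF Y, of 0] by (simp add: 1)
    have "uX 0 Y = - \<i> * \<alpha> * (g Y * plane_wave \<alpha> 0)" "qX 0 Y = - \<i> * \<alpha> * (q Y * plane_wave \<alpha> 0)"
      using vector_derivative_unique_at[OF sys(1)[OF Y, of 0] plane_wave_DERIV]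
        vector_derivative_unique_at[OF sys(4)[OF Y, of 0] plane_wave_DERIV] by blast+
    then show "- \<i> * of_real W * g Y + \<i> * \<alpha> * of_real (l * Y) * g Y - uYY 0 Y + \<i> * \<alpha> * q Y = 0"
      using sys(6)[OF Y, of 0] by (simp add: 1 algebra_simps)
  qed
next
  assume "\<exists>g1 g2. \<forall>Y>0. (g has_vector_derivative g1 Y) (at Y) \<and> (g1 has_vector_derivative g2 Y) (at Y) \<and>
       (q has_vector_derivative of_real l * g Y) (at Y) \<and>
       - \<i> * of_real W * g Y + \<i> * \<alpha> * of_real (l * Y) * g Y - g2 Y + \<i> * \<alpha> * q Y = 0"
  then obtain g1 g2 where g:
    "\<And>Y. Y > 0 \<Longrightarrow> (g has_vector_derivative g1 Y) (at Y)"
    "\<And>Y. Y > 0 \<Longrightarrow> (g1 has_vector_derivative g2 Y) (at Y)"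
    "\<And>Y. Y > 0 \<Longrightarrow> (q has_vector_derivative of_real l * g Y) (at Y)"
    "\<And>Y. Y > 0 \<Longrightarrow> - \<i> * of_real W * g Y + \<i> * \<alpha> * of_real (l * Y) * g Y - g2 Y + \<i> * \<alpha> * q Y = 0"
    by blast
  have *: "((\<lambda>y. f y * p) has_vector_derivative f' * p) (at Y)"
    if "(f has_vector_derivative f') (at Y)" for f :: "real \<Rightarrow> complex" and f' p Y
    using that by (rule has_vector_derivative_mult_left)
  show "adjoint_mode l W \<alpha> g q"
    unfolding adjoint_mode_def adjoint_system_def
  proof (intro exI allI impI conjI)
    fix X Y :: real assume Y: "Y > 0"
    show "((\<lambda>x. g Y * plane_wave \<alpha> x) has_vector_derivative - \<i> * \<alpha> * (g Y * plane_wave \<alpha> X)) (at X)"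
      "((\<lambda>x. q Y * plane_wave \<alpha> x) has_vector_derivative - \<i> * \<alpha> * (q Y * plane_wave \<alpha> X)) (at X)"
      by (rule plane_wave_DERIV)+
    show "((\<lambda>y. g y * plane_wave \<alpha> X) has_vector_derivative g1 Y * plane_wave \<alpha> X) (at Y)"
      "((\<lambda>y. g1 y * plane_wave \<alpha> X) has_vector_derivative g2 Y * plane_wave \<alpha> X) (at Y)"
      "((\<lambda>y. q y * plane_wave \<alpha> X) has_vector_derivative of_real l * g Y * plane_wave \<alpha> X) (at Y)"
      by (intro * g Y)+
    have "- \<i> * of_real W * (g Y * plane_wave \<alpha> X) - of_real (l * Y) * (- \<i> * \<alpha> * (g Y * plane_wave \<alpha> X))
        - g2 Y * plane_wave \<alpha> X - - \<i> * \<alpha> * (q Y * plane_wave \<alpha> X)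
      = (- \<i> * of_real W * g Y + \<i> * \<alpha> * of_real (l * Y) * g Y - g2 Y + \<i> * \<alpha> * q Y) * plane_wave \<alpha> X"
      by (simp add: algebra_simps)
    also have "\<dots> = 0" unfolding g(4)[OF Y] by simp
    finally show "- \<i> * of_real W * (g Y * plane_wave \<alpha> X) - of_real (l * Y) * (- \<i> * \<alpha> * (g Y * plane_wave \<alpha> X))
        - g2 Y * plane_wave \<alpha> X - - \<i> * \<alpha> * (q Y * plane_wave \<alpha> X) = 0" .
    show "of_real l * g Y * plane_wave \<alpha> X = of_real l * (g Y * plane_wave \<alpha> X)" by simp
  qed
qed

text \<open>\<open>F (z Y) / c\<close> is an antiderivative in \<open>Y\<close> that vanishes at
  infinity, so the integral is minus its value at \<open>Y = 0\<close>. The quadratic decay supplies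
  absolute integrability.\<close>

lemma set_integral_deriv_along_ray:
  fixes F f :: "complex \<Rightarrow> complex" and c z0 :: complex
  assumes "c \<noteq> 0"
  defines "z \<equiv> \<lambda>Y. c * of_real Y + z0"
  assumes F: "\<And>w. (F has_field_derivative f w) (at w)"
    and f: "continuous_on UNIV f"
    and lim: "((\<lambda>Y. F (z Y)) \<longlongrightarrow> 0) at_top"
    and decay: "(\<lambda>Y. norm (f (z Y))) \<in> O(\<lambda>Y. 1 / Y\<^sup>2)"
  shows "set_integrable lborel {0<..} (\<lambda>Y. f (z Y))"
    and "(LINT Y:{0<..}|lborel. f (z Y)) = - F z0 / c"
proof -
  have cont_z: "continuous_on S z" for S unfolding z_def by (intro continuous_intros)
  have cont: "continuous_on S (\<lambda>Y. f (z Y))" for S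
    by (rule continuous_on_compose2[OF f cont_z]) simp
  \<comment> \<open>Weighting with \<open>(1 + Y)^2\<close> instead of \<open>Y^2\<close> gives a
    majorant that is integrable at 0 as well.\<close>
  have "(\<lambda>Y. norm (f (z Y)) * (1 + Y)\<^sup>2) \<in> O(\<lambda>Y. 1 / Y\<^sup>2 * Y\<^sup>2)"
    by (intro landau_o.big.mult decay) real_asymp
  also have "(\<lambda>Y :: real. 1 / Y\<^sup>2 * Y\<^sup>2) \<in> O(\<lambda>_. 1)" by real_asymp
  finally obtain C where C: "eventually (\<lambda>Y. norm (norm (f (z Y)) * (1 + Y)\<^sup>2) \<le> C * norm (1 :: real)) at_top"
    by (elim landau_o.bigE)
  then obtain N where N: "\<And>Y. Y \<ge> N \<Longrightarrow> norm (f (z Y)) * (1 + Y)\<^sup>2 \<le> C"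
    by (auto simp: eventually_at_top_linorder)
  have "compact ((\<lambda>Y. norm (f (z Y)) * (1 + Y)\<^sup>2) ` {0..N})"
    by (intro compact_continuous_image continuous_intros cont) simp
  then obtain C' where C': "\<And>Y. Y \<in> {0..N} \<Longrightarrow> norm (f (z Y)) * (1 + Y)\<^sup>2 \<le> C'"
    by (auto dest!: compact_imp_bounded simp: bounded_iff) (metis abs_le_D1 image_eqI atLeastAtMost_iff)
  define K where "K = max C C'"
  have K: "norm (f (z Y)) \<le> K * (1 / (1 + Y)\<^sup>2)" if Y: "Y > 0" for Y
  proof -
    have "norm (f (z Y)) * (1 + Y)\<^sup>2 \<le> K"
      using N[of Y] C'[of Y] Y by (cases "Y \<ge> N") (auto simp: K_def)
    then show ?thesis using Y by (simp add: pos_le_divide_eq)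
  qed
  define G where "G Y = - 1 / (1 + Y)" for Y :: real
  have "set_integrable lborel (einterval 0 \<infinity>) (\<lambda>Y. 1 / (1 + Y)\<^sup>2)"
  proof (rule interval_integral_FTC_nonneg(1)[where F = G])
    show "DERIV G Y :> 1 / (1 + Y)\<^sup>2" if "0 < ereal Y" for Y
      unfolding G_def using that by (auto intro!: derivative_eq_intros simp: power2_eq_square)
    have "(G \<longlongrightarrow> - 1) (at_right 0)" "(G \<longlongrightarrow> 0) at_top" unfolding G_def by real_asymp+
    then show "((G \<circ> real_of_ereal) \<longlongrightarrow> - 1) (at_right 0)" "((G \<circ> real_of_ereal) \<longlongrightarrow> 0) (at_left \<infinity>)"
      by (simp_all add: ereal_tendsto_simps zero_ereal_def)
    show "isCont (\<lambda>Y. 1 / (1 + Y)\<^sup>2) Y" if "0 < ereal Y" for Y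
      using that by (auto intro!: continuous_intros)
  qed auto
  then have "set_integrable lborel {0<..} (\<lambda>Y. K * (1 / (1 + Y)\<^sup>2))"
    unfolding einterval_0_infinity by (rule set_integrable_mult_right)
  then show int: "set_integrable lborel {0<..} (\<lambda>Y. f (z Y))"
    by (rule set_integrable_Ioi_bound[OF _ cont K])
  have "(LINT Y:{0<..}|lborel. f (z Y)) = 0 - F z0 / c"
  proof (rule set_integral_FTC_Ioi[where F = "\<lambda>Y. F (z Y) / c", OF _ _ int])
    have z': "(z has_vector_derivative c) (at Y)" for Y
      unfolding z_def by (auto intro!: derivative_eq_intros)
    have deriv: "((\<lambda>Y. F (z Y) / c) has_vector_derivative f (z Y)) (at Y)" for Y
      using has_vector_derivative_divide[OF field_vector_diff_chain_at[OF z' F], of c] assms(1)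
      by (simp add: comp_def)
    then show "((\<lambda>Y. F (z Y) / c) has_vector_derivative f (z Y)) (at Y)" for Y .
    show "isCont (\<lambda>Y. f (z Y)) Y" for Y using cont[of UNIV] by (simp add: continuous_on_eq_continuous_at)
    have "isCont (\<lambda>Y. F (z Y) / c) 0" using deriv has_vector_derivative_continuous by blast
    then show "((\<lambda>Y. F (z Y) / c) \<longlongrightarrow> F z0 / c) (at_right 0)"
      by (auto simp: isCont_def z_def intro: tendsto_within_subset)
    show "((\<lambda>Y. F (z Y) / c) \<longlongrightarrow> 0) at_top"
      using tendsto_divide[OF lim tendsto_const] assms(1) by simp
  qed
  then show "(LINT Y:{0<..}|lborel. f (z Y)) = - F z0 / c" by simp
qed

section \<open>Solution spaces of the reduced equation and of the adjoint system\<close>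

lemma reduced_equation_z_iff:
  assumes "convex S"
  shows "reduced_equation_z S G \<longleftrightarrow>
    (\<exists>a1 a2 a3. \<forall>w\<in>S. G w = a1 * deriv Ai w + a2 * deriv Bi w + a3 * deriv Gi w)"
proof
  assume "reduced_equation_z S G"
  then obtain G1 G2 G3 where "\<forall>w\<in>S.
      (G has_field_derivative G1 w) (at w within S) \<and>
      (G1 has_field_derivative G2 w) (at w within S) \<and>
      (G2 has_field_derivative G3 w) (at w within S) \<and> G3 w - w * G1 w - 2 * G w = 0"
    unfolding reduced_equation_z_def by (elim exE)
  then have "\<exists>a1 a2 a3. \<forall>w\<in>S. G w = a1 * deriv Ai w + a2 * deriv Bi w + a3 * deriv Gi w
      \<and> G2 w - w * G w = a1 * Ai w + a2 * Bi w + a3 * Gi w"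
    by (intro third_order_span[OF assms, of G G1 G2 G3]) simp_all
  then show "\<exists>a1 a2 a3. \<forall>w\<in>S. G w = a1 * deriv Ai w + a2 * deriv Bi w + a3 * deriv Gi w"
    by blast
next
  assume "\<exists>a1 a2 a3. \<forall>w\<in>S. G w = a1 * deriv Ai w + a2 * deriv Bi w + a3 * deriv Gi w"
  then obtain a1 a2 a3 where a: "\<And>w. w \<in> S \<Longrightarrow> G w = a1 * deriv Ai w + a2 * deriv Bi w + a3 * deriv Gi w"
    by blast
  \<comment> \<open>\<open>F\<close> is defined on the whole plane and agrees with \<open>G\<close>
    on \<open>S\<close>; its derivatives pass to \<open>G\<close> within \<open>S\<close>.\<close>
  define F h where "F w = a1 * deriv Ai w + a2 * deriv Bi w + a3 * deriv Gi w"
    and "h w = a1 * Ai w + a2 * Bi w + a3 * Gi w" for w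
  note deriv = third_order_combination[of F a1 a2 a3 h, OF F_def h_def, where S = S]
  show "reduced_equation_z S G"
    unfolding reduced_equation_z_def
  proof (intro exI ballI conjI)
    fix w assume w: "w \<in> S"
    show "(G has_field_derivative w * h w - a3 / of_real pi) (at w within S)"
      by (rule has_field_derivative_transform_within[OF deriv(2) zero_less_one w]) (simp add: a F_def)
    show "2 * F w + w * (w * h w - a3 / of_real pi) - w * (w * h w - a3 / of_real pi) - 2 * G w = 0"
      using a[OF w] by (simp add: F_def)
  qed (rule deriv)+
qed

lemma companion_combination:
  assumes "\<And>w. w \<in> S \<Longrightarrow> G w = a1 * deriv Ai w + a2 * deriv Bi w + a3 * deriv Gi w"
    and h: "\<And>w. h w = a1 * Ai w + a2 * Bi w + a3 * Gi w"
  shows "companion S G h"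
    and "w \<in> S \<Longrightarrow> (h has_field_derivative G w) (at w within S)"
proof -
  define F where "F w = a1 * deriv Ai w + a2 * deriv Bi w + a3 * deriv Gi w" for w
  note deriv = third_order_combination[of F a1 a2 a3 h, OF F_def h, where S = S]
  have G: "G w = F w" if "w \<in> S" for w using assms(1)[OF that] by (simp add: F_def)
  show "companion S G h"
    unfolding companion_def
  proof (intro exI ballI conjI)
    fix w assume w: "w \<in> S"
    show "(G has_field_derivative w * h w - a3 / of_real pi) (at w within S)"
      by (rule has_field_derivative_transform_within[OF deriv(2) zero_less_one w]) (simp add: G)
    show "h w = h w + w * F w - w * G w" by (simp add: G w)
  qed (rule deriv)
  show "(h has_field_derivative G w) (at w within S)" if "w \<in> S"
    using deriv(1)[of w] by (simp add: G that)
qed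

text \<open>Isolates the algebra of the change of variables, which holds for every branch of the
  cube root. The branch enters through \<open>adjoint_sector\<close>.\<close>

locale adjoint_ray =
  fixes l W :: real and \<alpha> c z0 :: complex
  assumes c: "c \<noteq> 0" and c_cube: "c ^ 3 = \<i> * \<alpha> * of_real l" and c_z0: "c\<^sup>2 * z0 = - \<i> * of_real W"
begin

abbreviation "z \<equiv> \<lambda>Y. c * of_real Y + z0"
abbreviation "ray \<equiv> z ` {0<..}"
abbreviation "on_ray \<equiv> \<lambda>(f :: real \<Rightarrow> complex) w. f (Re ((w - z0) / c))"

lemma alpha_nonzero: "\<alpha> \<noteq> 0"
  using c c_cube by auto

text \<open>The reason for the choice of \<open>c\<close> and \<open>z0\<close>: the coefficient of
  the first derivative in \<open>Y\<close> becomes \<open>z\<close> after division by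
  \<open>c^2\<close>.\<close>

lemma z_scaled: "c\<^sup>2 * z Y = \<i> * \<alpha> * of_real l * of_real Y - \<i> * of_real W"
proof -
  have "c\<^sup>2 * z Y = c ^ 3 * of_real Y + c\<^sup>2 * z0" by (simp add: algebra_simps power2_eq_square power3_eq_cube)
  then show ?thesis unfolding c_cube c_z0 by simp
qed

lemma on_ray_z: "Re ((z Y - z0) / c) = Y"
  by (rule affine_ray_param[OF c])

text \<open>The divisor \<open>a\<close> carries the powers of \<open>c\<close> left by earlier
  derivatives, so the rule can be iterated.\<close>

lemma ray_DERIV:
  assumes "\<And>Y. Y > 0 \<Longrightarrow> (f has_vector_derivative f' Y) (at Y)" and "a \<noteq> 0" and "w \<in> ray"
  shows "((\<lambda>w. on_ray f w / a) has_field_derivative on_ray f' w / (a * c)) (at w within ray)"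
proof -
  obtain Y where Y: "Y > 0" "w = z Y" using assms(3) by auto
  have "((\<lambda>Y. f Y / a) has_vector_derivative f' Y / a) (at Y)"
    by (rule has_vector_derivative_divide[OF assms(1)[OF Y(1)]])
  then have "((\<lambda>Y. on_ray f (z Y) / a) has_vector_derivative c * (f' Y / (a * c))) (at Y)"
    unfolding on_ray_z using c by simp
  then show ?thesis
    unfolding Y(2) by (subst affine_ray_has_field_derivative[OF c Y(1)], unfold on_ray_z)
qed

lemma ray_DERIV_D:
  assumes "(F has_field_derivative D) (at (z Y) within ray)" and "Y > 0"
  shows "((\<lambda>Y. a * F (z Y)) has_vector_derivative a * c * D) (at Y)"
  using has_vector_derivative_mult_right[OF iffD1[OF affine_ray_has_field_derivative[OF c assms(2)] assms(1)], of a]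
  by (simp add: mult.assoc)

lemma reduced_equation_scaled:
  "d3 / c ^ 3 - z Y * (d1 / c) - 2 * d0 =
    (d3 - (\<i> * \<alpha> * of_real l * of_real Y - \<i> * of_real W) * d1 - 2 * \<i> * \<alpha> * of_real l * d0) / c ^ 3"
proof -
  have "d3 / c ^ 3 - z Y * (d1 / c) - 2 * d0 = (d3 - (c\<^sup>2 * z Y) * d1 - 2 * (c ^ 3) * d0) / c ^ 3"
    using c by (simp add: field_simps power2_eq_square power3_eq_cube)
  then show ?thesis unfolding z_scaled c_cube by (simp add: mult.assoc)
qed

lemma reduced_equation_Y_iff: "reduced_equation_Y l W \<alpha> g \<longleftrightarrow> reduced_equation_z ray (on_ray g)"
proof
  assume "reduced_equation_Y l W \<alpha> g"
  then obtain g1 g2 g3 where g: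
    "\<And>Y. Y > 0 \<Longrightarrow> (g has_vector_derivative g1 Y) (at Y)"
    "\<And>Y. Y > 0 \<Longrightarrow> (g1 has_vector_derivative g2 Y) (at Y)"
    "\<And>Y. Y > 0 \<Longrightarrow> (g2 has_vector_derivative g3 Y) (at Y)"
    "\<And>Y. Y > 0 \<Longrightarrow> g3 Y - (\<i> * \<alpha> * of_real l * of_real Y - \<i> * of_real W) * g1 Y - 2 * \<i> * \<alpha> * of_real l * g Y = 0"
    unfolding reduced_equation_Y_def by blast
  show "reduced_equation_z ray (on_ray g)"
    unfolding reduced_equation_z_def
  proof (intro exI ballI conjI)
    fix w assume w: "w \<in> ray"
    then obtain Y where Y: "Y > 0" "w = z Y" by auto
    show "(on_ray g has_field_derivative on_ray g1 w / c) (at w within ray)"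
      using ray_DERIV[OF g(1), of 1] w by simp
    show "((\<lambda>w. on_ray g1 w / c) has_field_derivative on_ray g2 w / c\<^sup>2) (at w within ray)"
      using ray_DERIV[OF g(2), of c] w c by (simp add: power2_eq_square)
    show "((\<lambda>w. on_ray g2 w / c\<^sup>2) has_field_derivative on_ray g3 w / c ^ 3) (at w within ray)"
      using ray_DERIV[OF g(3), of "c\<^sup>2"] w c by (simp add: power2_eq_square power3_eq_cube)
    show "on_ray g3 w / c ^ 3 - w * (on_ray g1 w / c) - 2 * on_ray g w = 0"
      unfolding Y(2) on_ray_z reduced_equation_scaled g(4)[OF Y(1)] by simp
  qed
next
  assume "reduced_equation_z ray (on_ray g)"
  then obtain G1 G2 G3 where G:
    "\<And>w. w \<in> ray \<Longrightarrow> (on_ray g has_field_derivative G1 w) (at w within ray)"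
    "\<And>w. w \<in> ray \<Longrightarrow> (G1 has_field_derivative G2 w) (at w within ray)"
    "\<And>w. w \<in> ray \<Longrightarrow> (G2 has_field_derivative G3 w) (at w within ray)"
    "\<And>w. w \<in> ray \<Longrightarrow> G3 w - w * G1 w - 2 * on_ray g w = 0"
    unfolding reduced_equation_z_def by blast
  show "reduced_equation_Y l W \<alpha> g"
    unfolding reduced_equation_Y_def
  proof (intro exI allI impI conjI)
    fix Y :: real assume Y: "Y > 0"
    then have w: "z Y \<in> ray" by blast
    show "(g has_vector_derivative c * G1 (z Y)) (at Y)"
      using ray_DERIV_D[OF G(1)[OF w] Y, of 1] unfolding on_ray_z by simp
    show "((\<lambda>Y. c * G1 (z Y)) has_vector_derivative c\<^sup>2 * G2 (z Y)) (at Y)"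
      using ray_DERIV_D[OF G(2)[OF w] Y, of c] by (simp add: power2_eq_square)
    show "((\<lambda>Y. c\<^sup>2 * G2 (z Y)) has_vector_derivative c ^ 3 * G3 (z Y)) (at Y)"
      using ray_DERIV_D[OF G(3)[OF w] Y, of "c\<^sup>2"] by (simp add: power2_eq_square power3_eq_cube)
    have "(c ^ 3 * G3 (z Y)) / c ^ 3 - z Y * ((c * G1 (z Y)) / c) - 2 * g Y = 0"
      using G(4)[OF w] c unfolding on_ray_z by simp
    then show "c ^ 3 * G3 (z Y) - (\<i> * \<alpha> * of_real l * of_real Y - \<i> * of_real W) * (c * G1 (z Y))
        - 2 * \<i> * \<alpha> * of_real l * g Y = 0"
      unfolding reduced_equation_scaled using c by simp
  qed
qed

lemma reduced_equation_Y_span: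
  "reduced_equation_Y l W \<alpha> g \<longleftrightarrow>
    (\<exists>a1 a2 a3. \<forall>Y\<in>{0<..}. g Y = a1 * deriv Ai (z Y) + a2 * deriv Bi (z Y) + a3 * deriv Gi (z Y))"
  unfolding reduced_equation_Y_iff reduced_equation_z_iff[OF convex_affine_ray[OF c]] ball_simps on_ray_z ..

text \<open>The momentum equation reads \<open>\<i> * \<alpha> * q = g2 - c^2 * z * g\<close>, which
  determines the pressure as a multiple of the companion; \<open>qY = l * g\<close> then turns its
  derivative into the third-order equation.\<close>

lemma adjoint_mode_span:
  "adjoint_mode l W \<alpha> g q \<longleftrightarrow>
    (\<exists>a1 a2 a3. \<forall>Y>0. g Y = a1 * deriv Ai (z Y) + a2 * deriv Bi (z Y) + a3 * deriv Gi (z Y) \<and>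
       q Y = c\<^sup>2 / (\<i> * \<alpha>) * (a1 * Ai (z Y) + a2 * Bi (z Y) + a3 * Gi (z Y)))"
proof
  assume "adjoint_mode l W \<alpha> g q"
  then obtain g1 g2 where g:
    "\<And>Y. Y > 0 \<Longrightarrow> (g has_vector_derivative g1 Y) (at Y)"
    "\<And>Y. Y > 0 \<Longrightarrow> (g1 has_vector_derivative g2 Y) (at Y)"
    "\<And>Y. Y > 0 \<Longrightarrow> (q has_vector_derivative of_real l * g Y) (at Y)"
    "\<And>Y. Y > 0 \<Longrightarrow> - \<i> * of_real W * g Y + \<i> * \<alpha> * of_real (l * Y) * g Y - g2 Y + \<i> * \<alpha> * q Y = 0"
    unfolding adjoint_mode_iff by blast
  \<comment> \<open>The system provides two derivatives of \<open>g\<close>; a third exists because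
    the momentum equation expresses \<open>g2\<close> through differentiable quantities. The term
    \<open>\<i> * \<alpha> * l * g\<close> arises twice, from the factor \<open>Y\<close> and from
    the derivative of \<open>q\<close>, whence the 2 in the reduced equation.\<close>
  define g3 where "g3 Y = - \<i> * of_real W * g1 Y
      + (\<i> * \<alpha> * of_real l * g Y + \<i> * \<alpha> * of_real (l * Y) * g1 Y) + \<i> * \<alpha> * (of_real l * g Y)" for Y
  have g2: "g2 Y = - \<i> * of_real W * g Y + \<i> * \<alpha> * of_real (l * Y) * g Y + \<i> * \<alpha> * q Y" if "Y > 0" for Y
    using g(4)[OF that] by (simp add: algebra_simps)
  have g3: "(g2 has_vector_derivative g3 Y) (at Y)" if Y: "Y > 0" for Y
  proof (rule has_vector_derivative_transform_within_open[where S = "{0<..}"])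
    show "((\<lambda>Y. - \<i> * of_real W * g Y + \<i> * \<alpha> * of_real (l * Y) * g Y + \<i> * \<alpha> * q Y)
        has_vector_derivative g3 Y) (at Y)"
      unfolding g3_def
      by (auto intro!: derivative_eq_intros g(1)[OF Y] g(3)[OF Y] simp: algebra_simps)
  qed (use Y g2 in auto)
  have "\<exists>a1 a2 a3. \<forall>w\<in>ray. on_ray g w = a1 * deriv Ai w + a2 * deriv Bi w + a3 * deriv Gi w
      \<and> on_ray g2 w / c\<^sup>2 - w * on_ray g w = a1 * Ai w + a2 * Bi w + a3 * Gi w"
  proof (rule third_order_span[OF convex_affine_ray[OF c]])
    fix w assume w: "w \<in> ray"
    then obtain Y where Y: "Y > 0" "w = z Y" by auto
    show "(on_ray g has_field_derivative on_ray g1 w / c) (at w within ray)"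
      using ray_DERIV[OF g(1), of 1] w by simp
    show "((\<lambda>w. on_ray g1 w / c) has_field_derivative on_ray g2 w / c\<^sup>2) (at w within ray)"
      using ray_DERIV[OF g(2), of c] w c by (simp add: power2_eq_square)
    show "((\<lambda>w. on_ray g2 w / c\<^sup>2) has_field_derivative on_ray g3 w / c ^ 3) (at w within ray)"
      using ray_DERIV[OF g3, of "c\<^sup>2"] w c by (simp add: power2_eq_square power3_eq_cube)
    have "g3 Y - (\<i> * \<alpha> * of_real l * of_real Y - \<i> * of_real W) * g1 Y - 2 * \<i> * \<alpha> * of_real l * g Y = 0"
      by (simp add: g3_def algebra_simps)
    then show "on_ray g3 w / c ^ 3 - w * (on_ray g1 w / c) - 2 * on_ray g w = 0"
      unfolding Y(2) on_ray_z reduced_equation_scaled by simp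
  qed
  then obtain a1 a2 a3 where a:
    "\<And>Y. Y > 0 \<Longrightarrow> g Y = a1 * deriv Ai (z Y) + a2 * deriv Bi (z Y) + a3 * deriv Gi (z Y)"
    "\<And>Y. Y > 0 \<Longrightarrow> g2 Y / c\<^sup>2 - z Y * g Y = a1 * Ai (z Y) + a2 * Bi (z Y) + a3 * Gi (z Y)"
    unfolding ball_simps on_ray_z by blast
  have "q Y = c\<^sup>2 / (\<i> * \<alpha>) * (a1 * Ai (z Y) + a2 * Bi (z Y) + a3 * Gi (z Y))" if Y: "Y > 0" for Y
  proof -
    have "c\<^sup>2 / (\<i> * \<alpha>) * (g2 Y / c\<^sup>2 - z Y * g Y) = (g2 Y - (c\<^sup>2 * z Y) * g Y) / (\<i> * \<alpha>)"
      using c alpha_nonzero by (simp add: field_simps)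
    also have "g2 Y - (c\<^sup>2 * z Y) * g Y = (\<i> * \<alpha>) * q Y"
      unfolding z_scaled g2[OF Y] by (simp add: algebra_simps)
    finally show ?thesis unfolding a(2)[OF Y] using alpha_nonzero by simp
  qed
  with a(1) show "\<exists>a1 a2 a3. \<forall>Y>0. g Y = a1 * deriv Ai (z Y) + a2 * deriv Bi (z Y) + a3 * deriv Gi (z Y) \<and>
       q Y = c\<^sup>2 / (\<i> * \<alpha>) * (a1 * Ai (z Y) + a2 * Bi (z Y) + a3 * Gi (z Y))"
    by blast
next
  assume "\<exists>a1 a2 a3. \<forall>Y>0. g Y = a1 * deriv Ai (z Y) + a2 * deriv Bi (z Y) + a3 * deriv Gi (z Y) \<and>
       q Y = c\<^sup>2 / (\<i> * \<alpha>) * (a1 * Ai (z Y) + a2 * Bi (z Y) + a3 * Gi (z Y))"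
  then obtain a1 a2 a3 where a:
    "\<And>Y. Y > 0 \<Longrightarrow> g Y = a1 * deriv Ai (z Y) + a2 * deriv Bi (z Y) + a3 * deriv Gi (z Y)"
    "\<And>Y. Y > 0 \<Longrightarrow> q Y = c\<^sup>2 / (\<i> * \<alpha>) * (a1 * Ai (z Y) + a2 * Bi (z Y) + a3 * Gi (z Y))"
    by blast
  define F h where "F w = a1 * deriv Ai w + a2 * deriv Bi w + a3 * deriv Gi w"
    and "h w = a1 * Ai w + a2 * Bi w + a3 * Gi w" for w
  define F1 where "F1 w = w * h w - a3 / of_real pi" for w
  note deriv = third_order_combination[of F a1 a2 a3 h, OF F_def h_def, where S = ray, folded F1_def]
  show "adjoint_mode l W \<alpha> g q"
    unfolding adjoint_mode_iff
  proof (intro exI allI impI conjI)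
    fix Y :: real assume Y: "Y > 0"
    show "(g has_vector_derivative c * F1 (z Y)) (at Y)"
      by (rule has_vector_derivative_transform_within_open[where S = "{0<..}" and f = "\<lambda>Y. F (z Y)"])
        (use ray_DERIV_D[OF deriv(2) Y, of 1] Y a in \<open>auto simp: F_def\<close>)
    show "((\<lambda>Y. c * F1 (z Y)) has_vector_derivative c\<^sup>2 * (h (z Y) + z Y * F (z Y))) (at Y)"
      using ray_DERIV_D[OF deriv(3) Y, of c] by (simp add: power2_eq_square)
    \<comment> \<open>The relation \<open>c^3 = \<i> * \<alpha> * l\<close> makes the factor
      \<open>c\<^sup>2 / (\<i> * \<alpha>)\<close> fit the pressure equation.\<close>
    have "c\<^sup>2 / (\<i> * \<alpha>) * c * F (z Y) = c ^ 3 / (\<i> * \<alpha>) * F (z Y)"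
      by (simp add: power2_eq_square power3_eq_cube)
    also have "\<dots> = of_real l * g Y" unfolding c_cube using alpha_nonzero a(1)[OF Y] by (simp add: F_def)
    finally have "((\<lambda>Y. c\<^sup>2 / (\<i> * \<alpha>) * h (z Y)) has_vector_derivative of_real l * g Y) (at Y)"
      using ray_DERIV_D[OF deriv(1) Y, of "c\<^sup>2 / (\<i> * \<alpha>)"] by metis
    then show "(q has_vector_derivative of_real l * g Y) (at Y)"
      by (rule has_vector_derivative_transform_within_open[where S = "{0<..}"]) (use Y a in \<open>auto simp: h_def\<close>)
    have "- \<i> * of_real W * g Y + \<i> * \<alpha> * of_real (l * Y) * g Y = (c\<^sup>2 * z Y) * g Y"
      unfolding z_scaled by (simp add: algebra_simps)
    moreover have "\<i> * \<alpha> * q Y = c\<^sup>2 * h (z Y)"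
      using alpha_nonzero a(2)[OF Y] by (simp add: h_def)
    moreover have "g Y = F (z Y)" using a(1)[OF Y] by (simp add: F_def)
    ultimately show "- \<i> * of_real W * g Y + \<i> * \<alpha> * of_real (l * Y) * g Y
        - c\<^sup>2 * (h (z Y) + z Y * F (z Y)) + \<i> * \<alpha> * q Y = 0"
      by (simp add: algebra_simps)
  qed
qed

lemma adjoint_mode_reduction:
  assumes "adjoint_mode l W \<alpha> g q"
  shows "reduced_equation_Y l W \<alpha> g" and "reduced_equation_z ray (on_ray g)"
    and "\<exists>h. companion ray (on_ray g) h \<and>
      (\<forall>w\<in>ray. (h has_field_derivative on_ray g w) (at w within ray)) \<and>
      (\<forall>Y>0. q Y = c\<^sup>2 / (\<i> * \<alpha>) * h (z Y))"
proof -
  obtain a1 a2 a3 where a: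
    "\<And>Y. Y > 0 \<Longrightarrow> g Y = a1 * deriv Ai (z Y) + a2 * deriv Bi (z Y) + a3 * deriv Gi (z Y)"
    "\<And>Y. Y > 0 \<Longrightarrow> q Y = c\<^sup>2 / (\<i> * \<alpha>) * (a1 * Ai (z Y) + a2 * Bi (z Y) + a3 * Gi (z Y))"
    using assms unfolding adjoint_mode_span by blast
  show "reduced_equation_Y l W \<alpha> g" unfolding reduced_equation_Y_span using a(1) by blast
  then show "reduced_equation_z ray (on_ray g)" unfolding reduced_equation_Y_iff .
  have G: "on_ray g w = a1 * deriv Ai w + a2 * deriv Bi w + a3 * deriv Gi w" if w: "w \<in> ray" for w
  proof -
    obtain Y where Y: "Y > 0" "w = z Y" using w by auto
    show ?thesis unfolding Y(2) on_ray_z by (rule a(1)[OF Y(1)])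
  qed
  define h where "h w = a1 * Ai w + a2 * Bi w + a3 * Gi w" for w
  note h = companion_combination[of ray "on_ray g" a1 a2 a3 h, OF G h_def]
  show "\<exists>h. companion ray (on_ray g) h \<and>
      (\<forall>w\<in>ray. (h has_field_derivative on_ray g w) (at w within ray)) \<and>
      (\<forall>Y>0. q Y = c\<^sup>2 / (\<i> * \<alpha>) * h (z Y))"
    using h a(2) unfolding h_def by blast
qed

lemma fundamental_system_ray:
  "fundamental_system {0<..} (reduced_equation_Y l W \<alpha>)
     (\<lambda>Y. deriv Ai (z Y)) (\<lambda>Y. deriv Bi (z Y)) (\<lambda>Y. deriv Gi (z Y))"
  unfolding fundamental_system_def
proof (intro conjI allI impI reduced_equation_Y_span)
  fix a1 a2 a3
  assume "\<forall>Y\<in>{0<..}. a1 * deriv Ai (z Y) + a2 * deriv Bi (z Y) + a3 * deriv Gi (z Y) = 0"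
  then have "a1 = 0 \<and> a2 = 0 \<and> a3 = 0"
    by (intro airy_deriv_independent[of ray] affine_ray_limit_point[OF c]) auto
  then show "a1 = 0" "a2 = 0" "a3 = 0" by auto
qed

end

lemma fundamental_system_plane:
  "fundamental_system UNIV (reduced_equation_z UNIV) (deriv Ai) (deriv Bi) (deriv Gi)"
  unfolding fundamental_system_def
proof (intro conjI allI impI reduced_equation_z_iff convex_UNIV)
  fix a1 a2 a3
  assume "\<forall>x\<in>UNIV. a1 * deriv Ai x + a2 * deriv Bi x + a3 * deriv Gi x = 0"
  then have "a1 = 0 \<and> a2 = 0 \<and> a3 = 0"
    by (intro airy_deriv_independent[of UNIV]) auto
  then show "a1 = 0" "a2 = 0" "a3 = 0" by auto
qed

text \<open>\<gamma> is the square root of \<open>c\<close> that scales the saddle point. Its sector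
  bounds |arg c| by pi/3, and within this bound the ray runs to infinity where \<open>Ai\<close> is
  recessive.\<close>

locale adjoint_sector = adjoint_ray +
  fixes \<gamma> :: complex
  assumes \<gamma>: "\<gamma> \<in> airy_sector" and c_square: "c = \<gamma>\<^sup>2"
begin

lemma Ai_bigo:
  "(\<lambda>Y. norm (Ai (z Y))) \<in> O(\<lambda>Y. exp (- (Re (\<gamma> ^ 3) / 3) * Y powr (3/2)))"
  "(\<lambda>Y. norm (deriv Ai (z Y))) \<in> O(\<lambda>Y. exp (- (Re (\<gamma> ^ 3) / 3) * Y powr (3/2)))"
  using Ai_decay[OF \<gamma>, of z0] unfolding c_square by auto

lemma Gi_bigtheta:
  "(\<lambda>Y. norm (Gi (z Y))) \<in> \<Theta>(\<lambda>Y. 1 / Y)"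
  "(\<lambda>Y. norm (deriv Gi (z Y))) \<in> \<Theta>(\<lambda>Y. 1 / Y\<^sup>2)"
  using tendsto_imp_bigtheta_ray[OF c, of "1 / of_real pi" z0 1 Gi] Gi_tendsto(1)[OF \<gamma>, of z0]
    tendsto_imp_bigtheta_ray[OF c, of "- 1 / of_real pi" z0 2 "deriv Gi"] Gi_tendsto(2)[OF \<gamma>, of z0]
  unfolding c_square by simp_all

text \<open>The Scorer component has a finite line state because \<open>deriv Gi\<close> is of order
  \<open>1 / Y^2\<close>; \<open>Gi\<close> itself, of order \<open>1 / Y\<close>, is not integrable
  at infinity.\<close>

lemma integrable_decay:
  "(\<lambda>Y. norm (deriv Ai (z Y))) \<in> O(\<lambda>Y. 1 / Y\<^sup>2)"
  "(\<lambda>Y. norm (deriv Gi (z Y))) \<in> O(\<lambda>Y. 1 / Y\<^sup>2)"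
proof -
  have "Re (\<gamma> ^ 3) > 0" by (rule airy_sector_cube_pos[OF \<gamma>])
  then have "(\<lambda>Y :: real. exp (- (Re (\<gamma> ^ 3) / 3) * Y powr (3/2))) \<in> O(\<lambda>Y. 1 / Y\<^sup>2)" by real_asymp
  with Ai_bigo(2) show "(\<lambda>Y. norm (deriv Ai (z Y))) \<in> O(\<lambda>Y. 1 / Y\<^sup>2)" by (rule landau_o.big_trans)
  show "(\<lambda>Y. norm (deriv Gi (z Y))) \<in> O(\<lambda>Y. 1 / Y\<^sup>2)" using Gi_bigtheta(2) by (rule bigthetaD1)
qed

lemma tendsto_0:
  "((\<lambda>Y. Ai (z Y)) \<longlongrightarrow> 0) at_top" "((\<lambda>Y. deriv Ai (z Y)) \<longlongrightarrow> 0) at_top"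
  "((\<lambda>Y. Gi (z Y)) \<longlongrightarrow> 0) at_top" "((\<lambda>Y. deriv Gi (z Y)) \<longlongrightarrow> 0) at_top"
proof -
  have *: "(f \<longlongrightarrow> 0) at_top" if "(\<lambda>Y. norm (f Y)) \<in> O(g)" "g \<in> o(\<lambda>_. 1 :: real)"
    for f :: "real \<Rightarrow> complex" and g :: "real \<Rightarrow> real"
    using smalloD_tendsto[OF landau_o.big_small_trans[OF that]] by (simp add: tendsto_norm_zero_iff)
  have "Re (\<gamma> ^ 3) > 0" by (rule airy_sector_cube_pos[OF \<gamma>])
  then have "(\<lambda>Y :: real. exp (- (Re (\<gamma> ^ 3) / 3) * Y powr (3/2))) \<in> o(\<lambda>_. 1)" by real_asymp
  then show "((\<lambda>Y. Ai (z Y)) \<longlongrightarrow> 0) at_top" "((\<lambda>Y. deriv Ai (z Y)) \<longlongrightarrow> 0) at_top"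
    by (rule *[OF Ai_bigo(1)], rule *[OF Ai_bigo(2)])
  have Gi_small: "(\<lambda>Y :: real. 1 / Y) \<in> o(\<lambda>_. 1)" "(\<lambda>Y :: real. 1 / Y\<^sup>2) \<in> o(\<lambda>_. 1)"
    by real_asymp+
  show "((\<lambda>Y. Gi (z Y)) \<longlongrightarrow> 0) at_top"
    by (rule *[OF bigthetaD1[OF Gi_bigtheta(1)] Gi_small(1)])
  show "((\<lambda>Y. deriv Gi (z Y)) \<longlongrightarrow> 0) at_top"
    by (rule *[OF bigthetaD1[OF Gi_bigtheta(2)] Gi_small(2)])
qed

lemma admissible_iff:
  "adjoint_mode l W \<alpha> g q \<and> admissible g q \<longleftrightarrow>
    (\<exists>A B. \<forall>Y>0.
      g Y = A * deriv Ai (z Y) + B * deriv Gi (z Y) \<and>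
      q Y = A * (c\<^sup>2 / (\<i> * \<alpha>) * Ai (z Y)) + B * (c\<^sup>2 / (\<i> * \<alpha>) * Gi (z Y)))"
proof
  assume "adjoint_mode l W \<alpha> g q \<and> admissible g q"
  then have mode: "adjoint_mode l W \<alpha> g q" and g0: "(g \<longlongrightarrow> 0) at_top" and q0: "(q \<longlongrightarrow> 0) at_top"
    by (auto simp: admissible_def)
  obtain a1 a2 a3 where a:
    "\<And>Y. Y > 0 \<Longrightarrow> g Y = a1 * deriv Ai (z Y) + a2 * deriv Bi (z Y) + a3 * deriv Gi (z Y)"
    "\<And>Y. Y > 0 \<Longrightarrow> q Y = c\<^sup>2 / (\<i> * \<alpha>) * (a1 * Ai (z Y) + a2 * Bi (z Y) + a3 * Gi (z Y))"
    using mode unfolding adjoint_mode_span by blast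
  have "((\<lambda>Y. g Y - a1 * deriv Ai (z Y) - a3 * deriv Gi (z Y)) \<longlongrightarrow> 0 - a1 * 0 - a3 * 0) at_top"
    by (intro tendsto_intros g0 tendsto_0)
  moreover have "eventually (\<lambda>Y. g Y - a1 * deriv Ai (z Y) - a3 * deriv Gi (z Y) = a2 * deriv Bi (z Y)) at_top"
    using eventually_gt_at_top[of 0] by eventually_elim (simp add: a(1))
  ultimately have Bi': "((\<lambda>Y. a2 * deriv Bi (z Y)) \<longlongrightarrow> 0) at_top"
    by (auto intro: Lim_transform_eventually)
  \<comment> \<open>Decay of \<open>g\<close> controls \<open>deriv Bi\<close>, decay of
    \<open>q\<close> controls \<open>Bi\<close>: both halves of admissibility enter the
    Wronskian.\<close>
  have "((\<lambda>Y. \<i> * \<alpha> / c\<^sup>2 * q Y - a1 * Ai (z Y) - a3 * Gi (z Y)) \<longlongrightarrow> \<i> * \<alpha> / c\<^sup>2 * 0 - a1 * 0 - a3 * 0) at_top"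
    by (intro tendsto_intros q0 tendsto_0)
  moreover have "eventually (\<lambda>Y. \<i> * \<alpha> / c\<^sup>2 * q Y - a1 * Ai (z Y) - a3 * Gi (z Y) = a2 * Bi (z Y)) at_top"
    using eventually_gt_at_top[of 0] by eventually_elim (simp add: a(2) c alpha_nonzero)
  ultimately have Bi: "((\<lambda>Y. a2 * Bi (z Y)) \<longlongrightarrow> 0) at_top"
    by (auto intro: Lim_transform_eventually)
  have "((\<lambda>Y. Ai (z Y) * (a2 * deriv Bi (z Y)) - deriv Ai (z Y) * (a2 * Bi (z Y))) \<longlongrightarrow> 0 * 0 - 0 * 0) at_top"
    by (intro tendsto_intros tendsto_0 Bi Bi')
  moreover have "Ai (z Y) * (a2 * deriv Bi (z Y)) - deriv Ai (z Y) * (a2 * Bi (z Y)) = a2 * airy_wronskian" for Y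
    unfolding airy_wronskian[of "z Y", symmetric] by (simp add: algebra_simps)
  ultimately have "a2 * airy_wronskian = 0" by (simp add: tendsto_const_iff)
  then have "a2 = 0" using airy_wronskian_nonzero by simp
  then show "\<exists>A B. \<forall>Y>0. g Y = A * deriv Ai (z Y) + B * deriv Gi (z Y) \<and>
      q Y = A * (c\<^sup>2 / (\<i> * \<alpha>) * Ai (z Y)) + B * (c\<^sup>2 / (\<i> * \<alpha>) * Gi (z Y))"
    using a by (intro exI[of _ a1] exI[of _ a3]) (simp add: algebra_simps)
next
  assume "\<exists>A B. \<forall>Y>0. g Y = A * deriv Ai (z Y) + B * deriv Gi (z Y) \<and>
      q Y = A * (c\<^sup>2 / (\<i> * \<alpha>) * Ai (z Y)) + B * (c\<^sup>2 / (\<i> * \<alpha>) * Gi (z Y))"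
  then obtain A B where AB:
    "\<And>Y. Y > 0 \<Longrightarrow> g Y = A * deriv Ai (z Y) + B * deriv Gi (z Y)"
    "\<And>Y. Y > 0 \<Longrightarrow> q Y = A * (c\<^sup>2 / (\<i> * \<alpha>) * Ai (z Y)) + B * (c\<^sup>2 / (\<i> * \<alpha>) * Gi (z Y))"
    by blast
  have "adjoint_mode l W \<alpha> g q"
    unfolding adjoint_mode_span
    by (intro exI[of _ A] exI[of _ 0] exI[of _ B]) (simp add: AB algebra_simps)
  moreover have "((\<lambda>Y. A * deriv Ai (z Y) + B * deriv Gi (z Y)) \<longlongrightarrow> A * 0 + B * 0) at_top"
    by (intro tendsto_intros tendsto_0)
  then have "(g \<longlongrightarrow> A * 0 + B * 0) at_top"
    by (rule Lim_transform_eventually) (rule eventually_mono[OF eventually_gt_at_top[of 0]], simp add: AB)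
  moreover have "((\<lambda>Y. A * (c\<^sup>2 / (\<i> * \<alpha>) * Ai (z Y)) + B * (c\<^sup>2 / (\<i> * \<alpha>) * Gi (z Y)))
      \<longlongrightarrow> A * (c\<^sup>2 / (\<i> * \<alpha>) * 0) + B * (c\<^sup>2 / (\<i> * \<alpha>) * 0)) at_top"
    by (intro tendsto_intros tendsto_0)
  then have "(q \<longlongrightarrow> A * (c\<^sup>2 / (\<i> * \<alpha>) * 0) + B * (c\<^sup>2 / (\<i> * \<alpha>) * 0)) at_top"
    by (rule Lim_transform_eventually) (rule eventually_mono[OF eventually_gt_at_top[of 0]], simp add: AB)
  ultimately show "adjoint_mode l W \<alpha> g q \<and> admissible g q" by (simp add: admissible_def)
qed

lemma line_states:
  assumes u: "\<forall>X. \<forall>Y>0. u X Y = (A * deriv Ai (z Y) + B * deriv Gi (z Y)) * plane_wave \<alpha> X"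
  shows "set_integrable lborel {0<..} (\<lambda>Y. u X Y)"
    and "line_U u X = - ((A * Ai z0 + B * Gi z0) / c) * plane_wave \<alpha> X"
    and "line_U u differentiable (at X)"
    and "line_b u X = \<i> * \<alpha> * ((A * Ai z0 + B * Gi z0) / c) * plane_wave \<alpha> X"
    and "has_fourier_symbol HD (\<lambda>k. of_real \<bar>k\<bar>) \<Longrightarrow> \<alpha> \<in> \<real> \<Longrightarrow> line_mu HD u X =
      of_real (norm \<alpha>) * (\<i> * \<alpha> * ((A * Ai z0 + B * Gi z0) / c)) * plane_wave \<alpha> X"
proof -
  define K where "K = (A * Ai z0 + B * Gi z0) / c"
  have cont: "continuous_on UNIV (deriv Ai)" "continuous_on UNIV (deriv Gi)"
    using airy_DERIV(4,6)[of _ UNIV] by (auto intro!: continuous_at_imp_continuous_on DERIV_isCont)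
  have I_Ai: "set_integrable lborel {0<..} (\<lambda>Y. deriv Ai (z Y))" "(LINT Y:{0<..}|lborel. deriv Ai (z Y)) = - Ai z0 / c"
    using set_integral_deriv_along_ray[OF c airy_DERIV(1) cont(1) tendsto_0(1) integrable_decay(1)] by auto
  have I_Gi: "set_integrable lborel {0<..} (\<lambda>Y. deriv Gi (z Y))" "(LINT Y:{0<..}|lborel. deriv Gi (z Y)) = - Gi z0 / c"
    using set_integral_deriv_along_ray[OF c airy_DERIV(3) cont(2) tendsto_0(3) integrable_decay(2)] by auto
  let ?f = "\<lambda>X Y. plane_wave \<alpha> X * (A * deriv Ai (z Y) + B * deriv Gi (z Y))"
  have f: "set_integrable lborel {0<..} (?f X)" "(LINT Y:{0<..}|lborel. ?f X Y) = - K * plane_wave \<alpha> X" for X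
  proof -
    show "set_integrable lborel {0<..} (?f X)"
      by (intro set_integrable_mult_right set_integral_add I_Ai I_Gi)
    have "(LINT Y:{0<..}|lborel. ?f X Y) = plane_wave \<alpha> X * (A * (- Ai z0 / c) + B * (- Gi z0 / c))"
      unfolding set_integral_mult_right
        set_integral_add(2)[OF set_integrable_mult_right[OF I_Ai(1)] set_integrable_mult_right[OF I_Gi(1)]]
        I_Ai(2) I_Gi(2) ..
    also have "\<dots> = - K * plane_wave \<alpha> X"
      by (simp add: K_def algebra_simps add_divide_distrib)
    finally show "(LINT Y:{0<..}|lborel. ?f X Y) = - K * plane_wave \<alpha> X" .
  qed
  have uf: "u X Y = ?f X Y" if "Y \<in> {0<..}" for X Y using u that by (simp add: mult.commute)
  show "set_integrable lborel {0<..} (\<lambda>Y. u X Y)"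
    using f(1)[of X] set_integrable_cong[OF refl refl uf, of "{0<..}" "\<lambda>Y. Y" lborel "\<lambda>_. X"] by simp
  have U: "line_U u X = - K * plane_wave \<alpha> X" for X
    unfolding line_U_def f(2)[symmetric] by (intro set_lebesgue_integral_cong) (use uf in auto)
  then show "line_U u X = - ((A * Ai z0 + B * Gi z0) / c) * plane_wave \<alpha> X" unfolding K_def .
  have U': "(line_U u has_vector_derivative - \<i> * \<alpha> * (- K * plane_wave \<alpha> X)) (at X)" for X
    unfolding U[abs_def] by (rule plane_wave_DERIV)
  then show "line_U u differentiable (at X)" by (rule differentiableI_vector)
  have b: "line_b u X = \<i> * \<alpha> * K * plane_wave \<alpha> X" for X
    unfolding line_b_def vector_derivative_at[OF U'] by simp
  then show "line_b u X = \<i> * \<alpha> * ((A * Ai z0 + B * Gi z0) / c) * plane_wave \<alpha> X" unfolding K_def .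
  assume HD: "has_fourier_symbol HD (\<lambda>k. of_real \<bar>k\<bar>)" and "\<alpha> \<in> \<real>"
  then obtain k where k: "\<alpha> = of_real k" by (auto elim: Reals_cases)
  \<comment> \<open>For real \<alpha> the line state is a single plane wave with real wave number,
    the kind of function on which \<open>has_fourier_symbol\<close> determines
    \<open>HD\<close>.\<close>
  have "line_b u = (\<lambda>X. (\<i> * \<alpha> * K) * plane_wave (of_real k) X)" using b k by auto
  then have "line_mu HD u X = of_real \<bar>k\<bar> * ((\<i> * \<alpha> * K) * plane_wave (of_real k) X)"
    using HD by (simp add: line_mu_def has_fourier_symbol_def)
  then show "line_mu HD u X = of_real (norm \<alpha>) * (\<i> * \<alpha> * ((A * Ai z0 + B * Gi z0) / c)) * plane_wave \<alpha> X"
    by (simp add: k K_def)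
qed

end

theorem theorem4p2:
  fixes l W :: real and \<alpha> :: complex
    and c z0 :: complex and z :: "real \<Rightarrow> complex" and ray :: "complex set"
    and on_ray :: "(real \<Rightarrow> complex) \<Rightarrow> complex \<Rightarrow> complex"
    and HD :: "(real \<Rightarrow> complex) \<Rightarrow> (real \<Rightarrow> complex)"
  assumes "l > 0" and "W > 0"
    and "\<alpha> \<noteq> 0" and "\<alpha> \<notin> {\<i> * of_real s | s. s \<ge> 0}"
    and "has_fourier_symbol HD (\<lambda>k. of_real \<bar>k\<bar>)"
  defines "c \<equiv> (\<i> * \<alpha> * of_real l) powr (1/3)"
    and "z0 \<equiv> - \<i> * of_real W / c\<^sup>2"
    and "z \<equiv> (\<lambda>Y. c * of_real Y + z0)"
    and "ray \<equiv> z ` {0<..}"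
    and "on_ray \<equiv> (\<lambda>g w. g (Re ((w - z0) / c)))"
  shows
    "(\<comment> \<open>reduction of a mode to the third-order equation; recovery of the pressure\<close>
      \<forall>g q. adjoint_mode l W \<alpha> g q \<longrightarrow>
         reduced_equation_Y l W \<alpha> g \<and>
         reduced_equation_z ray (on_ray g) \<and>
         (\<exists>h. companion ray (on_ray g) h \<and>
              (\<forall>w\<in>ray. (h has_field_derivative on_ray g w) (at w within ray)) \<and>
              (\<forall>Y>0. q Y = c\<^sup>2 / (\<i> * \<alpha>) * h (z Y))))
     \<and> (\<forall>g. reduced_equation_Y l W \<alpha> g \<longleftrightarrow> reduced_equation_z ray (on_ray g))
     \<and> \<comment> \<open>fundamental system, in the plane and along the ray, and companions\<close>
       fundamental_system UNIV (reduced_equation_z UNIV) (deriv Ai) (deriv Bi) (deriv Gi)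
     \<and> fundamental_system {0<..} (reduced_equation_Y l W \<alpha>)
         (\<lambda>Y. deriv Ai (z Y)) (\<lambda>Y. deriv Bi (z Y)) (\<lambda>Y. deriv Gi (z Y))
     \<and> companion UNIV (deriv Ai) Ai
     \<and> companion UNIV (deriv Bi) Bi
     \<and> companion UNIV (deriv Gi) Gi
     \<and> \<comment> \<open>admissible solutions\<close>
       (\<forall>g q. adjoint_mode l W \<alpha> g q \<and> admissible g q \<longleftrightarrow>
         (\<exists>A B. \<forall>Y>0.
            g Y = A * deriv Ai (z Y) + B * deriv Gi (z Y) \<and>
            q Y = A * (c\<^sup>2 / (\<i> * \<alpha>) * Ai (z Y)) + B * (c\<^sup>2 / (\<i> * \<alpha>) * Gi (z Y))))
     \<and> \<comment> \<open>recessive pair; algebraically decaying pair\<close>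
       (\<exists>\<kappa>>0. (\<lambda>Y. norm (Ai (z Y))) \<in> O(\<lambda>Y. exp (- \<kappa> * Y powr (3/2))) \<and>
               (\<lambda>Y. norm (deriv Ai (z Y))) \<in> O(\<lambda>Y. exp (- \<kappa> * Y powr (3/2))))
     \<and> (\<lambda>Y. norm (Gi (z Y))) \<in> \<Theta>(\<lambda>Y. 1 / Y)
     \<and> (\<lambda>Y. norm (deriv Gi (z Y))) \<in> \<Theta>(\<lambda>Y. 1 / Y\<^sup>2)
     \<and> \<comment> \<open>line states of an admissible mode\<close>
       (\<forall>A B u. (\<forall>X. \<forall>Y>0. u X Y =
            (A * deriv Ai (z Y) + B * deriv Gi (z Y)) * plane_wave \<alpha> X) \<longrightarrow>
         (\<forall>X. set_integrable lborel {0<..} (\<lambda>Y. u X Y) \<and>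
              line_U u X = - ((A * Ai z0 + B * Gi z0) / c) * plane_wave \<alpha> X \<and>
              line_U u differentiable (at X) \<and>
              line_b u X = \<i> * \<alpha> * ((A * Ai z0 + B * Gi z0) / c) * plane_wave \<alpha> X \<and>
              (\<alpha> \<in> \<real> \<longrightarrow> line_mu HD u X =
                 of_real (norm \<alpha>) * (\<i> * \<alpha> * ((A * Ai z0 + B * Gi z0) / c)) * plane_wave \<alpha> X)))
     \<and> \<comment> \<open>line states of the recessive component\<close>
       (\<forall>u. (\<forall>X. \<forall>Y>0. u X Y = deriv Ai (z Y) * plane_wave \<alpha> X) \<longrightarrow>
         (\<forall>X. line_U u X = - (Ai z0 / c) * plane_wave \<alpha> X \<and>
              line_b u X = (\<i> * \<alpha> * (Ai z0 / c)) * plane_wave \<alpha> X))"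
proof -
  define w where "w = \<i> * \<alpha> * of_real l"
  have w: "w \<notin> \<real>\<^sub>\<le>\<^sub>0"
  proof
    assume "w \<in> \<real>\<^sub>\<le>\<^sub>0"
    then obtain t where t: "t \<le> 0" "w = of_real t" by (auto elim: nonpos_Reals_cases)
    \<comment> \<open>The excluded half-line for \<alpha> is the preimage of the cut of the
      principal logarithm.\<close>
    then have "\<alpha> = \<i> * of_real (- t / l)"
      using \<open>l > 0\<close> by (simp add: w_def field_simps complex_eq_iff)
    moreover have "- t / l \<ge> 0" using t \<open>l > 0\<close> by (simp add: divide_nonpos_pos)
    ultimately show False using \<open>\<alpha> \<notin> {\<i> * of_real s | s. s \<ge> 0}\<close> by blast
  qed
  have c0: "c \<noteq> 0" using w by (auto simp: c_def w_def powr_def)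
  \<comment> \<open>The principal sixth root of \<open>\<i> * \<alpha> * l\<close> serves as the
    square root of \<open>c\<close> in the sector.\<close>
  interpret adjoint_sector l W \<alpha> c z0 "w powr (1/6)"
  proof
    show "c \<noteq> 0" by (rule c0)
    show "c ^ 3 = \<i> * \<alpha> * of_real l" using powr_sixth_airy_sector(3)[OF w] by (simp add: c_def w_def)
    show "c\<^sup>2 * z0 = - \<i> * of_real W" using c0 by (simp add: z0_def)
    show "w powr (1/6) \<in> airy_sector" by (rule powr_sixth_airy_sector(1)[OF w])
    show "c = (w powr (1/6))\<^sup>2" using powr_sixth_airy_sector(2)[OF w] by (simp add: c_def w_def)
  qed
  have recessive: "line_U u X = - (Ai z0 / c) * plane_wave \<alpha> X"
    "line_b u X = (\<i> * \<alpha> * (Ai z0 / c)) * plane_wave \<alpha> X"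
    if "\<forall>X. \<forall>Y>0. u X Y = deriv Ai (z Y) * plane_wave \<alpha> X" for u X
    using line_states(2,4)[of u 1 0 X] that by (simp_all add: z_def)
  have companions: "companion UNIV (deriv Ai) Ai" "companion UNIV (deriv Bi) Bi" "companion UNIV (deriv Gi) Gi"
    using companion_combination(1)[of UNIV _ 1 0 0] companion_combination(1)[of UNIV _ 0 1 0]
      companion_combination(1)[of UNIV _ 0 0 1] by simp_all
  have "Re ((w powr (1/6)) ^ 3) / 3 > 0" using airy_sector_cube_pos[OF \<gamma>] by simp
  with Ai_bigo have decay: "\<exists>\<kappa>>0. (\<lambda>Y. norm (Ai (c * of_real Y + z0))) \<in> O(\<lambda>Y. exp (- \<kappa> * Y powr (3/2))) \<and>
      (\<lambda>Y. norm (deriv Ai (c * of_real Y + z0))) \<in> O(\<lambda>Y. exp (- \<kappa> * Y powr (3/2)))"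
    by blast
  show ?thesis
    unfolding on_ray_def ray_def unfolding z_def
    by (intro conjI companions decay Gi_bigtheta fundamental_system_plane fundamental_system_ray)
      (intro allI impI, ((intro conjI impI)?; (rule adjoint_mode_reduction reduced_equation_Y_iff admissible_iff
      line_states recessive[unfolded z_def]; (assumption | rule assms(5)))))+
qed

end
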